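(* Let $k\ge 1$ be an integer and let $q$ be a prime power. The number of nondegenerate $2\times k\times(k+1)$ hypermatrices over the finite field $\mathbb{F}_q$ is $$q^{k^2}(q-1)^{2k}\,[k]!_q\,[k+1]!_q .$$
   Context: Notation: $[n]_q=1+q+\cdots+q^{n-1}$ and $[n]!_q=[1]_q[2]_q\cdots[n]_q$. A $2\times k\times(k+1)$ hypermatrix over a field $\mathbb{F}$ is an element of $\mathbb{F}^2\otimes\mathbb{F}^k\otimes\mathbb{F}^{k+1}$; it is written as a pair $(M_0,M_1)$ of $(k+1)\times k$ matrices over $\mathbb{F}$. It is degenerate (i.e. has zero hyperdeterminant) if there are nonzero vectors $x\in\overline{\mathbb{F}}^2$, $y\in\overline{\mathbb{F}}^k$, $z\in\overline{\mathbb{F}}^{k+1}$ at which the trilinear form $f(x,y,z)=\sum_{p,i,j}(M_p)_{ij}x_pz_iy_j$ and all its first partial derivatives vanish; for this format this is equivalent to the existence of nonzero $x\in\overline{\mathbb{F}}^2$, $y\in\overline{\mathbb{F}}^k$ with $(x_0M_0+x_1M_1)y=0$. Otherwise it is nondegenerate. *)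

theory Defs
  imports
    "HOL-Algebra.Algebraic_Closure_Type"
    "HOL-Library.Cardinality"
    "Jordan_Normal_Form.Matrix"
begin

no_notation fps_nth (infixl "$" 75)

definition q_int :: "'a::comm_semiring_1 \<Rightarrow> nat \<Rightarrow> 'a" where
  "q_int q n = (\<Sum>i<n. q ^ i)"

definition q_fact :: "'a::comm_semiring_1 \<Rightarrow> nat \<Rightarrow> 'a" where
  "q_fact q n = (\<Prod>m = 1..n. q_int q m)"

text \<open>
  A hypermatrix of format \<open>2 \<times> k \<times> (k+1)\<close> is the pair of its two slices, which are
  \<open>(k+1) \<times> k\<close> matrices.
\<close>

type_synonym 'a hypermatrix = "'a mat \<times> 'a mat"

definition hypermatrices :: "nat \<Rightarrow> 'a hypermatrix set" where
  "hypermatrices k = carrier_mat (k + 1) k \<times> carrier_mat (k + 1) k"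

definition slice :: "'a hypermatrix \<Rightarrow> nat \<Rightarrow> 'a mat" where
  "slice M p = (if p = 0 then fst M else snd M)"

definition map_hypermatrix :: "('a \<Rightarrow> 'b) \<Rightarrow> 'a hypermatrix \<Rightarrow> 'b hypermatrix" where
  "map_hypermatrix h = map_prod (map_mat h) (map_mat h)"

definition trilinear_form ::
  "'a::comm_semiring_1 hypermatrix \<Rightarrow> 'a vec \<Rightarrow> 'a vec \<Rightarrow> 'a vec \<Rightarrow> 'a" where
  "trilinear_form M x y z =
    (\<Sum>p<dim_vec x. \<Sum>i<dim_vec z. \<Sum>j<dim_vec y. slice M p $$ (i, j) * x $ p * z $ i * y $ j)"

text \<open>
  Formal partial derivatives (the characteristic may be positive): the variable with respect to
  which one differentiates is replaced by the polynomial indeterminate, all other variables by the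
  constants given by the point; the resulting univariate polynomial is differentiated and
  evaluated at the respective coordinate of the point.
\<close>

definition const_vec :: "'a::zero vec \<Rightarrow> 'a poly vec" where
  "const_vec v = map_vec (\<lambda>a. [:a:]) v"

definition indet_vec :: "'a::comm_semiring_1 vec \<Rightarrow> nat \<Rightarrow> 'a poly vec" where
  "indet_vec v m = vec (dim_vec v) (\<lambda>i. if i = m then [:0, 1:] else [:v $ i:])"

definition partial_x ::
  "'a::idom hypermatrix \<Rightarrow> nat \<Rightarrow> 'a vec \<Rightarrow> 'a vec \<Rightarrow> 'a vec \<Rightarrow> 'a" where
  "partial_x M p x y z =
    poly (pderiv (trilinear_form (map_hypermatrix (\<lambda>a. [:a:]) M)
      (indet_vec x p) (const_vec y) (const_vec z))) (x $ p)"

definition partial_y ::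
  "'a::idom hypermatrix \<Rightarrow> nat \<Rightarrow> 'a vec \<Rightarrow> 'a vec \<Rightarrow> 'a vec \<Rightarrow> 'a" where
  "partial_y M j x y z =
    poly (pderiv (trilinear_form (map_hypermatrix (\<lambda>a. [:a:]) M)
      (const_vec x) (indet_vec y j) (const_vec z))) (y $ j)"

definition partial_z ::
  "'a::idom hypermatrix \<Rightarrow> nat \<Rightarrow> 'a vec \<Rightarrow> 'a vec \<Rightarrow> 'a vec \<Rightarrow> 'a" where
  "partial_z M i x y z =
    poly (pderiv (trilinear_form (map_hypermatrix (\<lambda>a. [:a:]) M)
      (const_vec x) (const_vec y) (indet_vec z i))) (z $ i)"

definition degenerate :: "nat \<Rightarrow> 'a::field hypermatrix \<Rightarrow> bool" where
  "degenerate k M \<longleftrightarrow>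
    (let N = map_hypermatrix to_ac M in
      \<exists>x \<in> carrier_vec 2. \<exists>y \<in> carrier_vec k. \<exists>z \<in> carrier_vec (k + 1).
        x \<noteq> 0\<^sub>v 2 \<and> y \<noteq> 0\<^sub>v k \<and> z \<noteq> 0\<^sub>v (k + 1) \<and>
        trilinear_form N x y z = (0 :: 'a alg_closure) \<and>
        (\<forall>p<2. partial_x N p x y z = 0) \<and>
        (\<forall>j<k. partial_y N j x y z = 0) \<and>
        (\<forall>i<k + 1. partial_z N i x y z = 0))"

end

theory Submission
  imports Defs "Jordan_Normal_Form.Determinant"
begin

text \<open>
  Write a hypermatrix as a pencil \<open>x\<^sub>0 M\<^sub>0 + x\<^sub>1 M\<^sub>1\<close> of \<open>(k+1) \<times> k\<close> matrices. Degeneracy means that some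
  member of the pencil over the algebraic closure kills a nonzero vector \<open>y\<close>: the vanishing of
  the partial derivatives in \<open>z\<close> says exactly this, and the remaining equations amount to at most \<open>k\<close>
  independent linear conditions on the \<open>k+1\<close> coordinates of \<open>z\<close>
  (\<open>degenerate_iff_pencil_kernel\<close>).

  In a nondegenerate pencil \<open>M\<^sub>0\<close> has full column rank. Extend its columns by one more column to an
  invertible matrix \<open>Q\<close>. Then \<open>M\<^sub>0\<close> is \<open>Q\<close> times the identity with a zero row below it, and
  \<open>M\<^sub>1\<close> is \<open>Q\<close> times a square matrix \<open>N\<close> with a row \<open>w\<close> below it, where the pair \<open>(N, w)\<close> is arbitrary. In
  these coordinates a kernel vector of the pencil is an eigenvector of \<open>N\<close> that is annihilated
  by \<open>w\<close>. By the Hautus test from control theory there is no such eigenvector over the closure iff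
  the Krylov rows \<open>w, w N, \<dots>, w N\<^sup>k\<^sup>-\<^sup>1\<close> form an invertible matrix \<open>B\<close>
  (\<open>krylov_det_zero_iff_unobservable_eigenvector\<close>). This is a condition over the base field.

  The pairs that pass the test are easy to count, since \<open>(N, w)\<close> can be recovered from \<open>B\<close> and the next
  row \<open>u = w N\<^sup>k\<close>: the row \<open>w\<close> is the first row of \<open>B\<close>, and \<open>B N\<close> is \<open>B\<close> with its rows moved up by one and \<open>u\<close>
  put last. Every invertible \<open>B\<close> and every \<open>u\<close> arise (\<open>bij_betw_krylov\<close>). So there are
  \<open>|GL\<^sub>k| q\<^sup>k\<close> choices of \<open>M\<^sub>1\<close> for each \<open>M\<^sub>0\<close> of full column rank, and the theorem follows by counting matrices
  of full column rank column by column.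
\<close>

section \<open>Matrices of full column rank\<close>

text \<open>
  Padding \<open>A\<close> with zero rows to a square matrix \<open>B\<close> does not change the solutions; \<open>B\<close> is
  singular because its transpose kills a unit vector.
\<close>

lemma underdetermined_has_nonzero_solution:
  fixes A :: "'a::field mat"
  assumes A: "A \<in> carrier_mat r n" and "r < n"
  shows "\<exists>y \<in> carrier_vec n. y \<noteq> 0\<^sub>v n \<and> A *\<^sub>v y = 0\<^sub>v r"
proof -
  define B where "B = mat n n (\<lambda>(i,j). if i < r then A $$ (i,j) else 0)"
  have B: "B \<in> carrier_mat n n" by (simp add: B_def)
  have "transpose_mat B *\<^sub>v unit_vec n r = 0\<^sub>v n"
    by (rule eq_vecI) (use \<open>r < n\<close> in \<open>auto simp: B_def\<close>)
  moreover have "unit_vec n r \<noteq> (0\<^sub>v n :: 'a vec)"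
    using \<open>r < n\<close> by (simp add: unit_vec_nonzero)
  ultimately have "det (transpose_mat B) = 0"
    by (intro iffD2[OF det_0_iff_vec_prod_zero_field[OF transpose_carrier_mat[THEN iffD2, OF B]]]
        exI[of _ "unit_vec n r"] conjI unit_vec_carrier)
  then have "det B = 0" using det_transpose[OF B] by simp
  then obtain y where y: "y \<in> carrier_vec n" "y \<noteq> 0\<^sub>v n" "B *\<^sub>v y = 0\<^sub>v n"
    using det_0_iff_vec_prod_zero_field[OF B] by auto
  have "A *\<^sub>v y = 0\<^sub>v r"
  proof (rule eq_vecI)
    fix i assume "i < dim_vec (0\<^sub>v r :: 'a vec)"
    then have i: "i < r" by simp
    have "(A *\<^sub>v y) $ i = (B *\<^sub>v y) $ i"
      using i A y(1) \<open>r < n\<close> by (auto simp: B_def scalar_prod_def intro!: sum.cong)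
    then show "(A *\<^sub>v y) $ i = 0\<^sub>v r $ i" using y(3) i \<open>r < n\<close> by simp
  qed (use A in simp)
  with y show ?thesis by blast
qed

definition full_column_rank :: "'a::field mat \<Rightarrow> bool" where
  "full_column_rank A \<longleftrightarrow>
    (\<forall>y \<in> carrier_vec (dim_col A). A *\<^sub>v y = 0\<^sub>v (dim_row A) \<longrightarrow> y = 0\<^sub>v (dim_col A))"

lemma full_column_rank_square:
  "A \<in> carrier_mat n n \<Longrightarrow> full_column_rank A \<longleftrightarrow> det A \<noteq> 0"
  using det_0_iff_vec_prod_zero_field[of A n] by (auto simp: full_column_rank_def)

lemma full_column_rank_cancel:
  assumes "full_column_rank A" and A: "A \<in> carrier_mat n k"
    and y: "y \<in> carrier_vec k" "y' \<in> carrier_vec k" and eq: "A *\<^sub>v y = A *\<^sub>v y'"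
  shows "y = y'"
proof -
  have "A *\<^sub>v (y - y') = 0\<^sub>v n"
    using mult_minus_distrib_mat_vec[OF A y] eq A y by auto
  then have "y - y' = 0\<^sub>v k"
    using assms(1) A y unfolding full_column_rank_def by auto
  then have "\<And>i. i < k \<Longrightarrow> (y - y') $ i = 0" by simp
  then have "\<And>i. i < k \<Longrightarrow> y $ i = y' $ i" using y by simp
  then show ?thesis using y by (intro eq_vecI) auto
qed

lemma vec_eq_zero_iff: "v \<in> carrier_vec n \<Longrightarrow> v = 0\<^sub>v n \<longleftrightarrow> (\<forall>i<n. v $ i = 0)"
  unfolding vec_eq_iff[of v "0\<^sub>v n"] by simp

definition append_col :: "'a mat \<Rightarrow> 'a vec \<Rightarrow> 'a mat" where
  "append_col A c = mat (dim_row A) (Suc (dim_col A))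
    (\<lambda>(i,j). if j < dim_col A then A $$ (i,j) else c $ i)"

lemma append_col_carrier [simp]:
  "A \<in> carrier_mat n k \<Longrightarrow> append_col A c \<in> carrier_mat n (Suc k)"
  by (auto simp: append_col_def)

lemma append_col_mult_vec:
  fixes A :: "'a::field mat"
  assumes A: "A \<in> carrier_mat n k" and c: "c \<in> carrier_vec n" and y: "y \<in> carrier_vec (Suc k)"
  shows "append_col A c *\<^sub>v y = A *\<^sub>v vec k (($) y) + y $ k \<cdot>\<^sub>v c"
proof (rule eq_vecI)
  fix i assume "i < dim_vec (A *\<^sub>v vec k (($) y) + y $ k \<cdot>\<^sub>v c)"
  then have i: "i < n" using c by simp
  then show "(append_col A c *\<^sub>v y) $ i = (A *\<^sub>v vec k (($) y) + y $ k \<cdot>\<^sub>v c) $ i"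
    using A c y by (auto simp: append_col_def scalar_prod_def lessThan_Suc atLeast0_lessThan_Suc add.commute
        intro!: sum.cong)
qed (use A c in \<open>auto simp: append_col_def\<close>)

text \<open>
  This is the step of the column-by-column count: a further column preserves full column rank
  iff it avoids the span of the columns already present.
\<close>

lemma full_column_rank_append_col:
  fixes A :: "'a::field mat"
  assumes A: "A \<in> carrier_mat n k" and c: "c \<in> carrier_vec n"
  shows "full_column_rank (append_col A c) \<longleftrightarrow>
    full_column_rank A \<and> c \<notin> (*\<^sub>v) A ` carrier_vec k"
proof (intro iffI conjI notI)
  assume full: "full_column_rank (append_col A c)"
  have inj: "y = 0\<^sub>v (Suc k)"
    if "y \<in> carrier_vec (Suc k)" "A *\<^sub>v vec k (($) y) + y $ k \<cdot>\<^sub>v c = 0\<^sub>v n" for y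
    using full that append_col_mult_vec[OF A c] A
    by (auto simp: full_column_rank_def append_col_def)
  show "full_column_rank A"
    unfolding full_column_rank_def
  proof (intro ballI impI)
    fix y assume y: "y \<in> carrier_vec (dim_col A)" "A *\<^sub>v y = 0\<^sub>v (dim_row A)"
    let ?y = "vec (Suc k) (\<lambda>i. if i < k then y $ i else 0)"
    have "vec k (($) ?y) = y" using y A by (intro eq_vecI) auto
    then have "?y = 0\<^sub>v (Suc k)" using y A c by (intro inj) auto
    then have "?y $ i = 0" if "i < k" for i using that by simp
    then show "y = 0\<^sub>v (dim_col A)" using y A by (intro eq_vecI) auto
  qed
  assume "c \<in> (*\<^sub>v) A ` carrier_vec k"
  then obtain y where y: "y \<in> carrier_vec k" "c = A *\<^sub>v y" by blast
  let ?y = "vec (Suc k) (\<lambda>i. if i < k then y $ i else -1)"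
  have "vec k (($) ?y) = y" using y by (intro eq_vecI) auto
  then have "?y = 0\<^sub>v (Suc k)" using y A by (intro inj) auto
  then have "?y $ k = 0" by simp
  then show False by simp
next
  assume *: "full_column_rank A \<and> c \<notin> (*\<^sub>v) A ` carrier_vec k"
  show "full_column_rank (append_col A c)"
    unfolding full_column_rank_def
  proof (intro ballI impI)
    fix y assume "y \<in> carrier_vec (dim_col (append_col A c))"
      and "append_col A c *\<^sub>v y = 0\<^sub>v (dim_row (append_col A c))"
    then have y: "y \<in> carrier_vec (Suc k)" and 0: "A *\<^sub>v vec k (($) y) + y $ k \<cdot>\<^sub>v c = 0\<^sub>v n"
      using append_col_mult_vec[OF A c] A by (auto simp: append_col_def)
    have yk: "y $ k = 0"
    proof (rule ccontr)
      assume nz: "y $ k \<noteq> 0"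
      have "c = A *\<^sub>v ((- inverse (y $ k)) \<cdot>\<^sub>v vec k (($) y))"
      proof (rule eq_vecI)
        fix i assume "i < dim_vec (A *\<^sub>v ((- inverse (y $ k)) \<cdot>\<^sub>v vec k (($) y)))"
        then have i: "i < n" using A by simp
        have "(A *\<^sub>v vec k (($) y) + y $ k \<cdot>\<^sub>v c) $ i = 0" using 0 i by simp
        then have "(A *\<^sub>v vec k (($) y)) $ i = - (y $ k * c $ i)"
          using i A c by (simp add: add_eq_0_iff2)
        then show "c $ i = (A *\<^sub>v ((- inverse (y $ k)) \<cdot>\<^sub>v vec k (($) y))) $ i"
          using i A c nz by (simp add: mult_mat_vec[OF A] del: index_mult_mat_vec)
      qed (use A c in auto)
      with * show False by auto
    qed
    then have "A *\<^sub>v vec k (($) y) = 0\<^sub>v n"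
    proof -
      have "y $ k \<cdot>\<^sub>v c = 0\<^sub>v n" using yk c by auto
      then show ?thesis using 0 A by simp
    qed
    then have "vec k (($) y) = 0\<^sub>v k" using * A by (auto simp: full_column_rank_def)
    then have "vec k (($) y) $ i = 0" if "i < k" for i using that by simp
    then show "y = 0\<^sub>v (dim_col (append_col A c))"
      using y yk A by (intro eq_vecI) (auto simp: append_col_def less_Suc_eq)
  qed
qed

lemma bij_betw_append_col:
  "bij_betw (\<lambda>(A, c). append_col A c) (carrier_mat n k \<times> carrier_vec n) (carrier_mat n (Suc k))"
proof (rule bij_betw_byWitness[where f' = "\<lambda>B. (mat n k (($$) B), col B k)"])
  show "\<forall>B \<in> carrier_mat n (Suc k). (\<lambda>(A, c). append_col A c) (mat n k (($$) B), col B k) = B"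
    by (auto simp: append_col_def less_Suc_eq intro!: eq_matI)
qed (auto simp: append_col_def intro!: eq_matI eq_vecI)

lemma bij_betw_vec:
  "bij_betw (vec n) ({..<n} \<rightarrow>\<^sub>E UNIV) (carrier_vec n)"
  by (rule bij_betw_byWitness[where f' = "\<lambda>v. restrict (($) v) {..<n}"])
     (auto simp: PiE_def extensional_def restrict_def fun_eq_iff intro!: eq_vecI)

lemma card_carrier_vec:
  "card (carrier_vec n :: 'a::finite vec set) = CARD('a) ^ n"
  using bij_betw_same_card[OF bij_betw_vec[of n, where 'a = 'a]] by (simp add: card_PiE)

lemma finite_carrier_vec: "finite (carrier_vec n :: 'a::finite vec set)"
  using bij_betw_finite[OF bij_betw_vec[of n, where 'a = 'a]] by (simp add: finite_PiE)

lemma finite_carrier_mat: "finite (carrier_mat n k :: 'a::finite mat set)"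
proof (induction k)
  case 0
  have "carrier_mat n 0 \<subseteq> {mat n 0 undefined :: 'a mat}" by auto
  then show ?case by (rule finite_subset) simp
next
  case (Suc k)
  then show ?case
    using bij_betw_finite[OF bij_betw_append_col[of n k, where 'a = 'a]] finite_carrier_vec by blast
qed

text \<open>
  The columns of a matrix of full column rank with \<open>i\<close> columns span \<open>q\<^sup>i\<close> vectors, so there are
  \<open>q\<^sup>n - q\<^sup>i\<close> choices for the next column. For \<open>k > n\<close> both sides are zero, because of the
  factor with \<open>i = n\<close>.
\<close>

lemma card_full_column_rank:
  "card {A \<in> carrier_mat n k. full_column_rank (A :: 'a::{field,finite} mat)} =
    (\<Prod>i<k. CARD('a) ^ n - CARD('a) ^ i)"
proof (induction k)
  case 0
  have "{A \<in> carrier_mat n 0. full_column_rank (A :: 'a mat)} = {0\<^sub>m n 0}"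
    by (auto simp: full_column_rank_def intro!: eq_vecI)
  then show ?case by simp
next
  case (Suc k)
  let ?S = "{A \<in> carrier_mat n k. full_column_rank (A :: 'a mat)}"
  let ?C = "\<lambda>A :: 'a mat. carrier_vec n - (*\<^sub>v) A ` carrier_vec k"
  have fin: "finite ?S"
    by (rule finite_subset[OF _ finite_carrier_mat[of n k]]) auto
  have C: "card (?C A) = CARD('a) ^ n - CARD('a) ^ k" if "A \<in> ?S" for A
  proof -
    have "inj_on ((*\<^sub>v) A) (carrier_vec k)"
      using full_column_rank_cancel[of A n k] that by (auto simp: inj_on_def)
    then have "card ((*\<^sub>v) A ` carrier_vec k) = CARD('a) ^ k"
      by (simp add: card_image card_carrier_vec)
    moreover have "(*\<^sub>v) A ` carrier_vec k \<subseteq> carrier_vec n" using that by auto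
    ultimately show ?thesis
      by (subst card_Diff_subset) (auto simp: card_carrier_vec finite_carrier_vec finite_subset)
  qed
  have "bij_betw (\<lambda>(A, c). append_col A c) (SIGMA A:?S. ?C A)
      {A \<in> carrier_mat n (Suc k). full_column_rank (A :: 'a mat)}"
  proof (rule bij_betw_subset[OF bij_betw_append_col])
    show "(\<lambda>(A, c). append_col A c) ` (SIGMA A:?S. ?C A) =
        {A \<in> carrier_mat n (Suc k). full_column_rank (A :: 'a mat)}"
    proof (intro equalityI subsetI)
      fix B assume "B \<in> {A \<in> carrier_mat n (Suc k). full_column_rank (A :: 'a mat)}"
      then have B: "B \<in> carrier_mat n (Suc k)" "full_column_rank B" by auto
      then have "B \<in> (\<lambda>(A, c). append_col A c) ` (carrier_mat n k \<times> carrier_vec n)"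
        unfolding bij_betw_imp_surj_on[OF bij_betw_append_col[of n k, where 'a = 'a]] by simp
      then obtain A c where Ac: "A \<in> carrier_mat n k" "c \<in> carrier_vec n" "B = append_col A c"
        by (elim imageE SigmaE) simp
      then have "full_column_rank A" "c \<notin> (*\<^sub>v) A ` carrier_vec k"
        using B(2) full_column_rank_append_col[OF Ac(1,2)] by blast+
      with Ac show "B \<in> (\<lambda>(A, c). append_col A c) ` (SIGMA A:?S. ?C A)"
        by (intro image_eqI[where x = "(A, c)"]) simp_all
    next
      fix B assume "B \<in> (\<lambda>(A, c). append_col A c) ` (SIGMA A:?S. ?C A)"
      then obtain A c where Ac: "A \<in> ?S" "c \<in> ?C A" "B = append_col A c"
        by (elim imageE SigmaE) simp
      then have "A \<in> carrier_mat n k" "c \<in> carrier_vec n" by simp_all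
      then show "B \<in> {A \<in> carrier_mat n (Suc k). full_column_rank (A :: 'a mat)}"
        using Ac full_column_rank_append_col[of A n k c] by simp
    qed
  qed blast
  from bij_betw_same_card[OF this]
  have "card {A \<in> carrier_mat n (Suc k). full_column_rank (A :: 'a mat)} = (\<Sum>A\<in>?S. card (?C A))"
    using fin finite_carrier_vec[of n, where 'a = 'a] by (simp add: card_SigmaI)
  also have "\<dots> = card ?S * (CARD('a) ^ n - CARD('a) ^ k)" using C by simp
  finally show ?case using Suc.IH by simp
qed

lemma det_nonzero_obtains_inverse:
  fixes A :: "'a::field mat"
  assumes "A \<in> carrier_mat n n" "det A \<noteq> 0"
  obtains B where "B \<in> carrier_mat n n" "A * B = 1\<^sub>m n" "B * A = 1\<^sub>m n"
  using det_non_zero_imp_unit[OF assms, of "()"] by (auto simp: Units_def ring_mat_def)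

text \<open>
  A vector \<open>z\<close> orthogonal to all columns of \<open>A\<close> exists by counting equations. A unit vector on which
  \<open>z\<close> does not vanish is then outside the column span.
\<close>

lemma full_column_rank_extend_to_invertible:
  fixes A :: "'a::field mat"
  assumes A: "A \<in> carrier_mat (Suc k) k" and full: "full_column_rank A"
  obtains c where "c \<in> carrier_vec (Suc k)" "det (append_col A c) \<noteq> 0"
proof -
  obtain z where z: "z \<in> carrier_vec (Suc k)" "z \<noteq> 0\<^sub>v (Suc k)" "transpose_mat A *\<^sub>v z = 0\<^sub>v k"
    using underdetermined_has_nonzero_solution[of "transpose_mat A" k "Suc k"] A by auto
  then obtain i where i: "i < Suc k" "z $ i \<noteq> 0"
    by (metis carrier_vecD eq_vecI index_zero_vec(1) index_zero_vec(2))
  let ?c = "unit_vec (Suc k) i :: 'a vec"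
  have "?c \<noteq> A *\<^sub>v y" if y: "y \<in> carrier_vec k" for y
  proof
    assume "?c = A *\<^sub>v y"
    then have "z $ i = z \<bullet> (A *\<^sub>v y)" using z(1) i by (metis scalar_prod_right_unit)
    also have "\<dots> = (transpose_mat A *\<^sub>v z) \<bullet> y"
      using transpose_vec_mult_scalar[OF A y z(1)] by simp
    also have "\<dots> = 0" using z(3) y by simp
    finally show False using i by simp
  qed
  then have "full_column_rank (append_col A ?c)"
    using full full_column_rank_append_col[OF A, of ?c] by auto
  then have "det (append_col A ?c) \<noteq> 0"
    using full_column_rank_square[of "append_col A ?c" "Suc k"] A by simp
  then show ?thesis using that[of ?c] by simp
qed

section \<open>Degenerate hypermatrices and kernels of pencils\<close>

lemma pderiv_sum_over: "pderiv (sum f A) = (\<Sum>x\<in>A. pderiv (f x))"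
  using higher_pderiv_sum[of "Suc 0" f A] by simp

lemma trilinear_form_const_hypermatrix:
  assumes M: "slice M 0 \<in> carrier_mat (k+1) k" "slice M 1 \<in> carrier_mat (k+1) k"
    and "x \<in> carrier_vec 2" "y \<in> carrier_vec k" "z \<in> carrier_vec (k+1)"
  shows "trilinear_form (map_hypermatrix (\<lambda>a. [:a:]) M) x y z =
    (\<Sum>p<2. \<Sum>i<k+1. \<Sum>j<k. [:slice M p $$ (i, j):] * x $ p * z $ i * y $ j)"
proof -
  have "slice (map_hypermatrix (\<lambda>a. [:a:]) M) p $$ (i, j) = [:slice M p $$ (i, j):]"
    if "p < 2" "i < k + 1" "j < k" for p i j
    using M that by (cases M) (auto simp: slice_def map_hypermatrix_def less_2_cases_iff)
  then show ?thesis
    unfolding trilinear_form_def using assms(3-5) by (intro sum.cong) auto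
qed

lemma const_vec_carrier: "v \<in> carrier_vec n \<Longrightarrow> const_vec v \<in> carrier_vec n"
  and indet_vec_carrier: "v \<in> carrier_vec n \<Longrightarrow> indet_vec v m \<in> carrier_vec n"
  by (auto simp: const_vec_def indet_vec_def)

lemma const_vec_nth: "v \<in> carrier_vec n \<Longrightarrow> i < n \<Longrightarrow> const_vec v $ i = [:v $ i:]"
  and indet_vec_nth: "v \<in> carrier_vec n \<Longrightarrow> i < n \<Longrightarrow>
    indet_vec v m $ i = (if i = m then [:0, 1:] else [:v $ i:])"
  by (auto simp: const_vec_def indet_vec_def)

text \<open>
  The three formulas differ only in the position of the indeterminate; they cover the terms of the
  trilinear form differentiated in \<open>x\<close>, in \<open>z\<close> and in \<open>y\<close> respectively.
\<close>

lemma poly_pderiv_monomial_1: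
  "poly (pderiv ([:a:] * (if P then [:0, 1:] else [:s:]) * [:b:] * [:c:])) (t :: 'a::idom) =
    (if P then a * b * c else 0)"
  by (cases P) (simp_all add: pderiv_pCons)

lemma poly_pderiv_monomial_2:
  "poly (pderiv ([:a:] * [:b:] * (if P then [:0, 1:] else [:s:]) * [:c:])) (t :: 'a::idom) =
    (if P then a * b * c else 0)"
  by (cases P) (simp_all add: pderiv_pCons)

lemma poly_pderiv_monomial_3:
  "poly (pderiv ([:a:] * [:b:] * [:c:] * (if P then [:0, 1:] else [:s:]))) (t :: 'a::idom) =
    (if P then a * b * c else 0)"
  by (cases P) (simp_all add: pderiv_pCons)

context
  fixes M :: "'a::idom hypermatrix" and k :: nat and x y z :: "'a vec"
  assumes M: "slice M 0 \<in> carrier_mat (k+1) k" "slice M 1 \<in> carrier_mat (k+1) k"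
    and x: "x \<in> carrier_vec 2" and y: "y \<in> carrier_vec k" and z: "z \<in> carrier_vec (k+1)"
begin

lemma partial_z_eq:
  assumes "m < k + 1"
  shows "partial_z M m x y z = (\<Sum>p<2. \<Sum>j<k. slice M p $$ (m, j) * x $ p * y $ j)"
proof -
  have "partial_z M m x y z = (\<Sum>p<2. \<Sum>i<k+1. \<Sum>j<k.
      if i = m then slice M p $$ (m, j) * x $ p * y $ j else 0)"
    unfolding partial_z_def trilinear_form_const_hypermatrix[OF M const_vec_carrier[OF x]
        const_vec_carrier[OF y] indet_vec_carrier[OF z]] pderiv_sum_over poly_sum
    by (intro sum.cong refl)
       (simp only: lessThan_iff const_vec_nth[OF x] const_vec_nth[OF y] const_vec_nth[OF z]
          indet_vec_nth[OF x] indet_vec_nth[OF y] indet_vec_nth[OF z] poly_pderiv_monomial_2 cong: if_cong)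
  also have "\<dots> = (\<Sum>p<2. \<Sum>i<k+1. if i = m then \<Sum>j<k. slice M p $$ (m, j) * x $ p * y $ j else 0)"
    by (intro sum.cong refl) simp
  also have "\<dots> = (\<Sum>p<2. \<Sum>j<k. slice M p $$ (m, j) * x $ p * y $ j)"
    using assms by (simp add: sum.delta del: sum.lessThan_Suc)
  finally show ?thesis .
qed

lemma partial_y_eq:
  assumes "m < k"
  shows "partial_y M m x y z = (\<Sum>p<2. \<Sum>i<k+1. slice M p $$ (i, m) * x $ p * z $ i)"
proof -
  have "partial_y M m x y z = (\<Sum>p<2. \<Sum>i<k+1. \<Sum>j<k.
      if j = m then slice M p $$ (i, m) * x $ p * z $ i else 0)"
    unfolding partial_y_def trilinear_form_const_hypermatrix[OF M const_vec_carrier[OF x]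
        indet_vec_carrier[OF y] const_vec_carrier[OF z]] pderiv_sum_over poly_sum
    by (intro sum.cong refl)
       (simp only: lessThan_iff const_vec_nth[OF x] const_vec_nth[OF y] const_vec_nth[OF z]
          indet_vec_nth[OF x] indet_vec_nth[OF y] indet_vec_nth[OF z] poly_pderiv_monomial_3 cong: if_cong)
  also have "\<dots> = (\<Sum>p<2. \<Sum>i<k+1. slice M p $$ (i, m) * x $ p * z $ i)"
    using assms by (simp add: sum.delta del: sum.lessThan_Suc)
  finally show ?thesis .
qed

lemma partial_x_eq:
  assumes "m < 2"
  shows "partial_x M m x y z = (\<Sum>i<k+1. \<Sum>j<k. slice M m $$ (i, j) * z $ i * y $ j)"
proof -
  have "partial_x M m x y z = (\<Sum>p<2. \<Sum>i<k+1. \<Sum>j<k.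
      if p = m then slice M m $$ (i, j) * z $ i * y $ j else 0)"
    unfolding partial_x_def trilinear_form_const_hypermatrix[OF M indet_vec_carrier[OF x]
        const_vec_carrier[OF y] const_vec_carrier[OF z]] pderiv_sum_over poly_sum
    by (intro sum.cong refl)
       (simp only: lessThan_iff const_vec_nth[OF x] const_vec_nth[OF y] const_vec_nth[OF z]
          indet_vec_nth[OF x] indet_vec_nth[OF y] indet_vec_nth[OF z] poly_pderiv_monomial_1 cong: if_cong)
  also have "\<dots> = (\<Sum>p<2. if p = m then \<Sum>i<k+1. \<Sum>j<k. slice M m $$ (i, j) * z $ i * y $ j else 0)"
    by (intro sum.cong refl) simp
  also have "\<dots> = (\<Sum>i<k+1. \<Sum>j<k. slice M m $$ (i, j) * z $ i * y $ j)"
    using assms by (simp add: sum.delta del: sum.lessThan_Suc)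
  finally show ?thesis .
qed

end

lemma trilinear_form_eq:
  assumes "x \<in> carrier_vec 2" "y \<in> carrier_vec k" "z \<in> carrier_vec (k+1)"
  shows "trilinear_form M x y z =
    (\<Sum>p<2. \<Sum>i<k+1. \<Sum>j<k. slice M p $$ (i, j) * x $ p * z $ i * y $ j)"
  using assms by (simp add: trilinear_form_def)

definition pencil :: "'a::semiring_0 mat \<Rightarrow> 'a mat \<Rightarrow> 'a vec \<Rightarrow> 'a mat" where
  "pencil M0 M1 x = x $ 0 \<cdot>\<^sub>m M0 + x $ 1 \<cdot>\<^sub>m M1"

text \<open>
  The derivatives in \<open>z\<close> are the coordinates of the pencil at \<open>x\<close> applied to \<open>y\<close>. Conversely, given
  a kernel vector \<open>y\<close>, a suitable \<open>z\<close> has to be orthogonal to the \<open>k\<close> columns of the pencil at \<open>x\<close> and to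
  the two vectors obtained by applying the slices to \<open>y\<close>. The relation between the columns given by
  \<open>y\<close> makes one column condition redundant, and the relation between the two vectors given by \<open>x\<close> makes one of
  them redundant. This leaves \<open>k\<close> equations for \<open>k + 1\<close> unknowns.
\<close>

lemma degenerate_iff_pencil_kernel:
  assumes M: "M \<in> hypermatrices k"
  shows "degenerate k M \<longleftrightarrow> (\<exists>x \<in> carrier_vec 2. \<exists>y \<in> carrier_vec k.
    x \<noteq> 0\<^sub>v 2 \<and> y \<noteq> 0\<^sub>v k \<and>
    pencil (map_mat to_ac (fst M)) (map_mat to_ac (snd M)) x *\<^sub>v y = 0\<^sub>v (k+1))"
proof -
  define N where "N = map_hypermatrix to_ac M"
  have N: "slice N 0 \<in> carrier_mat (k+1) k" "slice N 1 \<in> carrier_mat (k+1) k"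
    using M by (auto simp: N_def slice_def map_hypermatrix_def hypermatrices_def)
  have slN: "map_mat to_ac (fst M) = slice N 0" "map_mat to_ac (snd M) = slice N 1"
    by (simp_all add: N_def slice_def map_hypermatrix_def)
  have pencil_nth: "(pencil (slice N 0) (slice N 1) x *\<^sub>v y) $ i =
      (\<Sum>p<2. \<Sum>j<k. slice N p $$ (i, j) * x $ p * y $ j)"
    if "x \<in> carrier_vec 2" "y \<in> carrier_vec k" "i < k + 1" for x y i
  proof -
    have "(pencil (slice N 0) (slice N 1) x *\<^sub>v y) $ i =
        (\<Sum>j<k. (x $ 0 * slice N 0 $$ (i, j) + x $ 1 * slice N 1 $$ (i, j)) * y $ j)"
    proof -
      have "(pencil (slice N 0) (slice N 1) x *\<^sub>v y) $ i = row (pencil (slice N 0) (slice N 1) x) i \<bullet> y"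
        using N that by (intro index_mult_mat_vec) (simp add: pencil_def)
      also have "\<dots> = (\<Sum>j<k. pencil (slice N 0) (slice N 1) x $$ (i, j) * y $ j)"
        unfolding scalar_prod_def carrier_vecD[OF that(2)] lessThan_atLeast0
        using N that by (intro sum.cong refl) (simp add: pencil_def)
      finally show ?thesis
        using N that by (simp add: pencil_def)
    qed
    also have "\<dots> = (\<Sum>j<k. slice N 0 $$ (i, j) * x $ 0 * y $ j) +
        (\<Sum>j<k. slice N 1 $$ (i, j) * x $ 1 * y $ j)"
      unfolding sum.distrib[symmetric] by (intro sum.cong refl) (simp add: algebra_simps)
    finally show ?thesis by (simp add: numeral_2_eq_2)
  qed
  have kernel_iff: "pencil (slice N 0) (slice N 1) x *\<^sub>v y = 0\<^sub>v (k+1) \<longleftrightarrow>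
      (\<forall>i<k+1. partial_z N i x y z = 0)"
    if "x \<in> carrier_vec 2" "y \<in> carrier_vec k" "z \<in> carrier_vec (k+1)" for x y z
  proof -
    have "pencil (slice N 0) (slice N 1) x *\<^sub>v y = 0\<^sub>v (k+1) \<longleftrightarrow>
        (\<forall>i<k+1. (pencil (slice N 0) (slice N 1) x *\<^sub>v y) $ i = 0)"
    proof
      assume "\<forall>i<k+1. (pencil (slice N 0) (slice N 1) x *\<^sub>v y) $ i = 0"
      moreover have "dim_vec (pencil (slice N 0) (slice N 1) x *\<^sub>v y) = k + 1"
        using N by (simp add: pencil_def)
      ultimately show "pencil (slice N 0) (slice N 1) x *\<^sub>v y = 0\<^sub>v (k+1)"
        by (intro eq_vecI) (auto simp del: index_mult_mat_vec)
    qed auto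
    then show ?thesis using that by (simp only: partial_z_eq[OF N that] pencil_nth cong: all_cong)
  qed
  have critical_z: "\<exists>z \<in> carrier_vec (k+1). z \<noteq> 0\<^sub>v (k+1) \<and> trilinear_form N x y z = 0 \<and>
      (\<forall>p<2. partial_x N p x y z = 0) \<and> (\<forall>j<k. partial_y N j x y z = 0)"
    if x: "x \<in> carrier_vec 2" "x \<noteq> 0\<^sub>v 2" and y: "y \<in> carrier_vec k" "y \<noteq> 0\<^sub>v k"
      and ker: "pencil (slice N 0) (slice N 1) x *\<^sub>v y = 0\<^sub>v (k+1)" for x y
  proof -
    obtain p where p: "p < 2" "x $ p \<noteq> 0" using x
      by (metis carrier_vecD eq_vecI index_zero_vec(1) index_zero_vec(2))
    obtain l where l: "l < k" "y $ l \<noteq> 0" using y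
      by (metis carrier_vecD eq_vecI index_zero_vec(1) index_zero_vec(2))
    define a where "a i j = (\<Sum>p<2. slice N p $$ (i, j) * x $ p)" for i j
    define b where "b p i = (\<Sum>j<k. slice N p $$ (i, j) * y $ j)" for p i
    \<comment> \<open>The independent conditions on \<open>z\<close>: the redundant column \<open>l\<close> gives up its row to the slice other than \<open>p\<close>.\<close>
    define G where "G = mat k (k+1) (\<lambda>(j,i). if j = l then b (1 - p) i else a i j)"
    have ay: "(\<Sum>j<k. a i j * y $ j) = 0" if "i < k + 1" for i
    proof -
      have "(\<Sum>j<k. a i j * y $ j) = (\<Sum>p<2. \<Sum>j<k. slice N p $$ (i, j) * x $ p * y $ j)"
        unfolding a_def sum_distrib_right by (rule sum.swap)
      then show ?thesis using pencil_nth[OF x(1) y(1) that] ker that by simp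
    qed
    have bx: "(\<Sum>p<2. x $ p * b p i) = 0" if "i < k + 1" for i
    proof -
      have "(\<Sum>p<2. x $ p * b p i) = (\<Sum>p<2. \<Sum>j<k. slice N p $$ (i, j) * x $ p * y $ j)"
        unfolding b_def sum_distrib_left by (intro sum.cong refl) (simp add: mult_ac)
      then show ?thesis using pencil_nth[OF x(1) y(1) that] ker that by simp
    qed
    have "G \<in> carrier_mat k (k+1)" by (simp add: G_def)
    from underdetermined_has_nonzero_solution[OF this]
    obtain z where z: "z \<in> carrier_vec (k+1)" "z \<noteq> 0\<^sub>v (k+1)" "G *\<^sub>v z = 0\<^sub>v k" by auto
    have Gz: "(\<Sum>i<k+1. G $$ (j, i) * z $ i) = 0" if "j < k" for j
    proof -
      have "(G *\<^sub>v z) $ j = (\<Sum>i<k+1. G $$ (j, i) * z $ i)"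
        using that z(1) by (simp add: G_def scalar_prod_def lessThan_atLeast0 del: sum.op_ivl_Suc)
      then show ?thesis using z(3) that by simp
    qed
    have az': "(\<Sum>i<k+1. a i j * z $ i) = 0" if "j < k" "j \<noteq> l" for j
      using Gz[OF that(1)] that by (simp add: G_def del: sum.lessThan_Suc)
    \<comment> \<open>The condition from column \<open>l\<close> is recovered from the others because \<open>y\<close> is nonzero at \<open>l\<close>.\<close>
    have az_l: "(\<Sum>i<k+1. a i l * z $ i) = 0"
    proof -
      have "0 = (\<Sum>i<k+1. (\<Sum>j<k. a i j * y $ j) * z $ i)" using ay by simp
      also have "\<dots> = (\<Sum>j<k. (\<Sum>i<k+1. a i j * z $ i) * y $ j)"
        unfolding sum_distrib_right by (subst sum.swap) (intro sum.cong refl, simp add: mult_ac)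
      also have "\<dots> = (\<Sum>j<k. if j = l then (\<Sum>i<k+1. a i l * z $ i) * y $ l else 0)"
        using az' by (intro sum.cong) auto
      also have "\<dots> = (\<Sum>i<k+1. a i l * z $ i) * y $ l" using l by simp
      finally show ?thesis using l by simp
    qed
    have az: "(\<Sum>i<k+1. a i j * z $ i) = 0" if "j < k" for j
      using az' az_l that by blast
    have bz': "(\<Sum>i<k+1. b (1 - p) i * z $ i) = 0"
      using Gz[OF l(1)] l by (simp add: G_def del: sum.lessThan_Suc)
    have two: "(\<Sum>r<2. f r) = f p + f (1 - p)" for f :: "nat \<Rightarrow> 'a alg_closure"
      using p(1) by (auto simp: numeral_2_eq_2 less_Suc_eq add.commute)
    have "0 = (\<Sum>i<k+1. (\<Sum>r<2. x $ r * b r i) * z $ i)" using bx by simp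
    also have "\<dots> = x $ p * (\<Sum>i<k+1. b p i * z $ i) + x $ (1 - p) * (\<Sum>i<k+1. b (1 - p) i * z $ i)"
      by (simp only: two distrib_right sum.distrib sum_distrib_left mult.assoc)
    finally have bzp: "(\<Sum>i<k+1. b p i * z $ i) = 0" using bz' p by simp
    have bz: "(\<Sum>i<k+1. b r i * z $ i) = 0" if "r < 2" for r
    proof -
      have "r = p \<or> r = 1 - p" using p that by auto
      then show ?thesis using bzp bz' by blast
    qed
    have "partial_x N r x y z = 0" if "r < 2" for r
      unfolding partial_x_eq[OF N x(1) y(1) z(1) that] bz[OF that, symmetric] b_def sum_distrib_right
      by (intro sum.cong refl) (simp add: mult_ac)
    moreover have "partial_y N j x y z = 0" if "j < k" for j
      unfolding partial_y_eq[OF N x(1) y(1) z(1) that] az[OF that, symmetric] a_def sum_distrib_right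
      by (rule sum.swap)
    moreover have "trilinear_form N x y z = (\<Sum>r<2. x $ r * (\<Sum>i<k+1. b r i * z $ i))"
      unfolding trilinear_form_eq[OF x(1) y(1) z(1)] b_def sum_distrib_right sum_distrib_left
      by (intro sum.cong refl) (simp add: mult_ac)
    ultimately show ?thesis using z bz by auto
  qed
  show ?thesis
    unfolding degenerate_def Let_def N_def[symmetric] slN
  proof (intro iffI; elim bexE conjE)
    fix x y z
    assume "x \<in> carrier_vec 2" "y \<in> carrier_vec k" "z \<in> carrier_vec (k+1)"
      "x \<noteq> 0\<^sub>v 2" "y \<noteq> 0\<^sub>v k" "\<forall>i<k+1. partial_z N i x y z = 0"
    then show "\<exists>x \<in> carrier_vec 2. \<exists>y \<in> carrier_vec k. x \<noteq> 0\<^sub>v 2 \<and> y \<noteq> 0\<^sub>v k \<and>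
        pencil (slice N 0) (slice N 1) x *\<^sub>v y = 0\<^sub>v (k+1)"
      using kernel_iff by blast
  next
    fix x y
    assume xy: "x \<in> carrier_vec 2" "y \<in> carrier_vec k" "x \<noteq> 0\<^sub>v 2" "y \<noteq> 0\<^sub>v k"
      "pencil (slice N 0) (slice N 1) x *\<^sub>v y = 0\<^sub>v (k+1)"
    then obtain z where z: "z \<in> carrier_vec (k+1)" "z \<noteq> 0\<^sub>v (k+1)" "trilinear_form N x y z = 0"
      "\<forall>p<2. partial_x N p x y z = 0" "\<forall>j<k. partial_y N j x y z = 0"
      using critical_z by blast
    moreover have "\<forall>i<k+1. partial_z N i x y z = 0"
      using kernel_iff[OF xy(1,2) z(1)] xy(5) by blast
    ultimately show "\<exists>x \<in> carrier_vec 2. \<exists>y \<in> carrier_vec k. \<exists>z \<in> carrier_vec (k+1).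
        x \<noteq> 0\<^sub>v 2 \<and> y \<noteq> 0\<^sub>v k \<and> z \<noteq> 0\<^sub>v (k+1) \<and> trilinear_form N x y z = 0 \<and>
        (\<forall>p<2. partial_x N p x y z = 0) \<and> (\<forall>j<k. partial_y N j x y z = 0) \<and>
        (\<forall>i<k+1. partial_z N i x y z = 0)"
      using xy by blast
  qed
qed

section \<open>The Hautus test\<close>

definition iterates :: "'a::semiring_0 mat \<Rightarrow> 'a vec \<Rightarrow> nat \<Rightarrow> 'a vec" where
  "iterates N v i = ((*\<^sub>v) N ^^ i) v"

lemma iterates_0 [simp]: "iterates N v 0 = v"
  and iterates_Suc: "iterates N v (Suc i) = N *\<^sub>v iterates N v i"
  by (simp_all add: iterates_def)

lemma iterates_carrier [simp]:
  "N \<in> carrier_mat k k \<Longrightarrow> v \<in> carrier_vec k \<Longrightarrow> iterates N v i \<in> carrier_vec k"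
  by (induction i) (auto simp: iterates_Suc)

lemma dim_iterates:
  "N \<in> carrier_mat k k \<Longrightarrow> v \<in> carrier_vec k \<Longrightarrow> dim_vec (iterates N v i) = k"
  using carrier_vecD[OF iterates_carrier] .

text \<open>
  The usual existence proof for eigenvectors, carried out inside the \<open>N\<close>-invariant kernel of \<open>C\<close>.
  For a polynomial \<open>p\<close> of degree at most \<open>k\<close>, the vector \<open>V p\<close> in the proof is \<open>p(N) y\<close>. Some nonzero \<open>p\<close> satisfies
  \<open>p(N) y = 0\<close> as the \<open>k + 1\<close> vectors \<open>N\<^sup>j y\<close> are dependent. Splitting off linear factors
  \<open>X - \<mu>\<close> from \<open>p\<close> one at a time, there is a first quotient \<open>s\<close> with \<open>s(N) y \<noteq> 0\<close>, and this vector is an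
  eigenvector.
\<close>

lemma invariant_kernel_has_eigenvector:
  fixes N C :: "'a::alg_closed_field mat"
  assumes N: "N \<in> carrier_mat k k" and C: "C \<in> carrier_mat m k"
    and invariant: "\<And>y. y \<in> carrier_vec k \<Longrightarrow> C *\<^sub>v y = 0\<^sub>v m \<Longrightarrow> C *\<^sub>v (N *\<^sub>v y) = 0\<^sub>v m"
    and y: "y \<in> carrier_vec k" "y \<noteq> 0\<^sub>v k" "C *\<^sub>v y = 0\<^sub>v m"
  shows "\<exists>\<mu>. \<exists>z \<in> carrier_vec k. z \<noteq> 0\<^sub>v k \<and> C *\<^sub>v z = 0\<^sub>v m \<and> N *\<^sub>v z = \<mu> \<cdot>\<^sub>v z"
proof -
  define W where "W = mat k (Suc k) (\<lambda>(i,j). iterates N y j $ i)"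
  define V where "V p = W *\<^sub>v vec (Suc k) (Polynomial.coeff p)" for p
  have W: "W \<in> carrier_mat k (Suc k)" by (simp add: W_def)
  have V: "V p \<in> carrier_vec k" for p using W by (simp add: V_def)
  have V_nth: "V p $ i = (\<Sum>j<Suc k. iterates N y j $ i * Polynomial.coeff p j)" if "i < k" for p i
    using that by (simp add: V_def W_def scalar_prod_def lessThan_atLeast0 del: sum.op_ivl_Suc)
  have iter_kernel: "C *\<^sub>v iterates N y j = 0\<^sub>v m" for j
    by (induction j) (use invariant N y in \<open>auto simp: iterates_Suc\<close>)
  have V_kernel: "C *\<^sub>v V p = 0\<^sub>v m" for p
  proof -
    have "C * W = 0\<^sub>m m (Suc k)"
    proof (rule eq_matI)
      fix i j assume "i < dim_row (0\<^sub>m m (Suc k) :: 'a mat)" "j < dim_col (0\<^sub>m m (Suc k) :: 'a mat)"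
      then have ij: "i < m" "j < Suc k" by auto
      have "col W j = iterates N y j"
        using ij dim_iterates[OF N y(1)] by (intro eq_vecI) (auto simp: W_def)
      then have "(C * W) $$ (i, j) = (C *\<^sub>v iterates N y j) $ i" using ij C W by simp
      then show "(C * W) $$ (i, j) = 0\<^sub>m m (Suc k) $$ (i, j)" using iter_kernel ij by simp
    qed (use C W in auto)
    moreover have "0\<^sub>m m (Suc k) *\<^sub>v v = 0\<^sub>v m" if "v \<in> carrier_vec (Suc k)" for v :: "'a vec"
      using that by (intro eq_vecI) (auto simp: scalar_prod_def)
    ultimately show ?thesis
      unfolding V_def using assoc_mult_mat_vec[OF C W, of "vec (Suc k) (Polynomial.coeff p)"]
      by simp
  qed
  have N_V: "N *\<^sub>v V p = V (pCons 0 p)" if "degree p < k" for p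
  proof (rule eq_vecI)
    fix i assume "i < dim_vec (V (pCons 0 p))"
    then have i: "i < k" using V[of "pCons 0 p"] by simp
    have ck: "Polynomial.coeff p k = 0" using that by (rule coeff_eq_0)
    have "(N *\<^sub>v V p) $ i = (\<Sum>l<k. N $$ (i,l) * V p $ l)"
      using i N V[of p] by (simp add: scalar_prod_def lessThan_atLeast0 del: sum.op_ivl_Suc)
    also have "\<dots> = (\<Sum>l<k. \<Sum>j<Suc k. N $$ (i,l) * iterates N y j $ l * Polynomial.coeff p j)"
      by (intro sum.cong refl) (simp add: V_nth sum_distrib_left mult.assoc del: sum.lessThan_Suc)
    also have "\<dots> = (\<Sum>j<Suc k. (\<Sum>l<k. N $$ (i,l) * iterates N y j $ l) * Polynomial.coeff p j)"
      unfolding sum_distrib_right by (rule sum.swap)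
    also have "\<dots> = (\<Sum>j<Suc k. iterates N y (Suc j) $ i * Polynomial.coeff p j)"
      using i N dim_iterates[OF N y(1)]
      by (intro sum.cong refl) (simp add: iterates_Suc scalar_prod_def lessThan_atLeast0)
    also have "\<dots> = (\<Sum>j<k. iterates N y (Suc j) $ i * Polynomial.coeff p j)"
      using ck by simp
    also have "\<dots> = V (pCons 0 p) $ i"
      using i by (simp add: V_nth sum.lessThan_Suc_shift del: sum.lessThan_Suc)
    finally show "(N *\<^sub>v V p) $ i = V (pCons 0 p) $ i" .
  qed (use N V[of "pCons 0 p"] in auto)
  have V_root: "V ([:- \<mu>, 1:] * s) = N *\<^sub>v V s - \<mu> \<cdot>\<^sub>v V s" if "degree s < k" for \<mu> s
  proof (rule eq_vecI)
    fix i assume "i < dim_vec (N *\<^sub>v V s - \<mu> \<cdot>\<^sub>v V s)"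
    then have i: "i < k" using V[of s] by simp
    have "V ([:- \<mu>, 1:] * s) $ i = V (pCons 0 s) $ i - \<mu> * V s $ i"
      using i by (simp add: V_nth sum_distrib_left sum_subtractf[symmetric] algebra_simps
          del: sum.lessThan_Suc)
    then show "V ([:- \<mu>, 1:] * s) $ i = (N *\<^sub>v V s - \<mu> \<cdot>\<^sub>v V s) $ i"
      using i V[of s] by (simp add: N_V[OF that])
  qed (use V[of s] V[of "[:- \<mu>, 1:] * s"] in auto)
  have eigen: ?thesis if "p \<noteq> 0" "degree p \<le> k" "V p = 0\<^sub>v k" for p
    using that
  proof (induction "degree p" arbitrary: p rule: less_induct)
    case less
    show ?case
    proof (cases "degree p = 0")
      case True
      then obtain c where c: "p = [:c:]" by (metis degree_eq_zeroE)
      have "V p $ i = c * y $ i" if "i < k" for i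
        using that c by (simp add: V_nth sum.lessThan_Suc_shift del: sum.lessThan_Suc)
      then have "y $ i = 0" if "i < k" for i using that less.prems c by auto
      then have "y = 0\<^sub>v k" using y(1) by (intro eq_vecI) auto
      with y show ?thesis by simp
    next
      case False
      then obtain \<mu> where "poly p \<mu> = 0" using alg_closed_imp_poly_has_root[of p] by auto
      then obtain s where s: "p = [:- \<mu>, 1:] * s" by (metis dvdE poly_eq_0_iff_dvd)
      have "s \<noteq> 0" using s less.prems by auto
      then have deg: "degree p = Suc (degree s)" unfolding s by (subst degree_mult_eq) auto
      show ?thesis
      proof (cases "V s = 0\<^sub>v k")
        case True
        then show ?thesis using less.hyps[of s] \<open>s \<noteq> 0\<close> deg less.prems by simp
      next
        case False
        have eq: "N *\<^sub>v V s - \<mu> \<cdot>\<^sub>v V s = 0\<^sub>v k"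
          using V_root[of s \<mu>] s deg less.prems by simp
        have "N *\<^sub>v V s = \<mu> \<cdot>\<^sub>v V s"
        proof (rule eq_vecI)
          fix i assume "i < dim_vec (\<mu> \<cdot>\<^sub>v V s)"
          then have i: "i < k" using V[of s] by simp
          have "(N *\<^sub>v V s - \<mu> \<cdot>\<^sub>v V s) $ i = 0" using eq i by simp
          then show "(N *\<^sub>v V s) $ i = (\<mu> \<cdot>\<^sub>v V s) $ i" using i N V[of s] by simp
        qed (use N V[of s] in auto)
        then show ?thesis using False V[of s] V_kernel[of s] by blast
      qed
    qed
  qed
  obtain c where c: "c \<in> carrier_vec (Suc k)" "c \<noteq> 0\<^sub>v (Suc k)" "W *\<^sub>v c = 0\<^sub>v k"
    using underdetermined_has_nonzero_solution[OF W] by auto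
  define p where "p = (\<Sum>j\<le>k. Polynomial.monom (c $ j) j)"
  have coeff_p: "Polynomial.coeff p j = (if j \<le> k then c $ j else 0)" for j
    by (simp add: p_def coeff_sum if_distrib cong: if_cong)
  have cvec: "vec (Suc k) (Polynomial.coeff p) = c"
    using c(1) by (intro eq_vecI) (auto simp: coeff_p)
  have "p \<noteq> 0"
  proof
    assume "p = 0"
    then have "vec (Suc k) (Polynomial.coeff p) = 0\<^sub>v (Suc k)" by (intro eq_vecI) auto
    with cvec c show False by simp
  qed
  moreover have "degree p \<le> k" by (rule degree_le) (simp add: coeff_p)
  moreover have "V p = 0\<^sub>v k" using cvec c by (simp add: V_def)
  ultimately show ?thesis using eigen by blast
qed

text \<open>
  The rows are \<open>w, w N, w N\<^sup>2, \<dots>\<close>; as vectors are columns here, they are iterated images of \<open>w\<close> under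
  the transpose of \<open>N\<close>.
\<close>

definition krylov_mat :: "'a::comm_semiring_0 mat \<Rightarrow> 'a vec \<Rightarrow> nat \<Rightarrow> 'a mat" where
  "krylov_mat N w m = mat m (dim_vec w) (\<lambda>(i,j). iterates (transpose_mat N) w i $ j)"

lemma krylov_mat_carrier [simp]: "w \<in> carrier_vec k \<Longrightarrow> krylov_mat N w m \<in> carrier_mat m k"
  by (simp add: krylov_mat_def)

lemma krylov_mat_mult_vec:
  assumes N: "N \<in> carrier_mat k k" and w: "w \<in> carrier_vec k"
  shows "krylov_mat N w m *\<^sub>v y = vec m (\<lambda>i. iterates (transpose_mat N) w i \<bullet> y)"
proof (rule eq_vecI)
  fix i assume "i < dim_vec (vec m (\<lambda>i. iterates (transpose_mat N) w i \<bullet> y))"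
  then have i: "i < m" by simp
  have "row (krylov_mat N w m) i = iterates (transpose_mat N) w i"
    using i w dim_iterates[OF transpose_carrier_mat[THEN iffD2, OF N] w, of i]
    by (intro eq_vecI) (auto simp: krylov_mat_def)
  then show "(krylov_mat N w m *\<^sub>v y) $ i = vec m (\<lambda>i. iterates (transpose_mat N) w i \<bullet> y) $ i"
    using i by (simp add: krylov_mat_def[of N w m] del: row_mat)
qed (simp add: krylov_mat_def)

lemma krylov_scalar_prod_Suc:
  assumes N: "(N :: 'a::comm_semiring_0 mat) \<in> carrier_mat k k" and w: "w \<in> carrier_vec k" and y: "y \<in> carrier_vec k"
  shows "iterates (transpose_mat N) w (Suc i) \<bullet> y = iterates (transpose_mat N) w i \<bullet> (N *\<^sub>v y)"
  using transpose_vec_mult_scalar[OF N y, of "iterates (transpose_mat N) w i"] N w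
  by (simp add: iterates_Suc)

text \<open>
  The Hautus test. If \<open>N y = \<mu> y\<close> and \<open>w \<bullet> y = 0\<close> then each row \<open>w N\<^sup>i\<close> takes the value
  \<open>\<mu>\<^sup>i (w \<bullet> y) = 0\<close> at \<open>y\<close>. Conversely, suppose that the first \<open>k\<close> rows are dependent, and let \<open>m < k\<close> be the
  last row that occurs in a dependency. The common kernel of the first \<open>m\<close> rows is nonzero, as there are
  fewer than \<open>k\<close> of them, and invariant under \<open>N\<close>, as row \<open>m\<close> vanishes on it too. So it
  contains an eigenvector.
\<close>

lemma krylov_det_zero_iff_unobservable_eigenvector:
  fixes N :: "'a::alg_closed_field mat"
  assumes N: "N \<in> carrier_mat k k" and w: "w \<in> carrier_vec k"
  shows "det (krylov_mat N w k) = 0 \<longleftrightarrow>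
    (\<exists>\<mu>. \<exists>y \<in> carrier_vec k. y \<noteq> 0\<^sub>v k \<and> N *\<^sub>v y = \<mu> \<cdot>\<^sub>v y \<and> w \<bullet> y = 0)"
proof
  let ?r = "iterates (transpose_mat N) w"
  have NT: "transpose_mat N \<in> carrier_mat k k" using N by simp
  have r: "?r i \<in> carrier_vec k" for i using NT w by simp
  {
    assume "\<exists>\<mu>. \<exists>y \<in> carrier_vec k. y \<noteq> 0\<^sub>v k \<and> N *\<^sub>v y = \<mu> \<cdot>\<^sub>v y \<and> w \<bullet> y = 0"
    then obtain \<mu> y where y: "y \<in> carrier_vec k" "y \<noteq> 0\<^sub>v k" and ev: "N *\<^sub>v y = \<mu> \<cdot>\<^sub>v y" and "w \<bullet> y = 0"
      by blast
    have "?r i \<bullet> y = 0" for i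
    proof (induction i)
      case (Suc i)
      have "?r (Suc i) \<bullet> y = ?r i \<bullet> (\<mu> \<cdot>\<^sub>v y)"
        using krylov_scalar_prod_Suc[OF N w y(1)] ev by simp
      also have "\<dots> = \<mu> * (?r i \<bullet> y)" using r[of i] y(1) by simp
      finally show ?case using Suc by simp
    qed (use \<open>w \<bullet> y = 0\<close> in simp)
    then have "krylov_mat N w k *\<^sub>v y = 0\<^sub>v k"
      by (auto simp: krylov_mat_mult_vec[OF N w])
    then show "det (krylov_mat N w k) = 0"
      using det_0_iff_vec_prod_zero_field[of "krylov_mat N w k" k] w y by auto
  }
  assume "det (krylov_mat N w k) = 0"
  then have "det (transpose_mat (krylov_mat N w k)) = 0"
    using det_transpose[of "krylov_mat N w k" k] w by simp
  then obtain c where c: "c \<in> carrier_vec k" "c \<noteq> 0\<^sub>v k"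
      and dep: "transpose_mat (krylov_mat N w k) *\<^sub>v c = 0\<^sub>v k"
    using det_0_iff_vec_prod_zero_field[of "transpose_mat (krylov_mat N w k)" k] w by auto
  have "\<exists>i<k. c $ i \<noteq> 0" using c
    by (metis carrier_vecD eq_vecI index_zero_vec(1) index_zero_vec(2))
  define m where "m = Max {i. i < k \<and> c $ i \<noteq> 0}"
  have "m \<in> {i. i < k \<and> c $ i \<noteq> 0}"
    unfolding m_def using \<open>\<exists>i<k. c $ i \<noteq> 0\<close> by (intro Max_in) auto
  then have m: "m < k" "c $ m \<noteq> 0" by auto
  have c_above: "c $ i = 0" if "m < i" "i < k" for i
    using Max_ge[of "{i. i < k \<and> c $ i \<noteq> 0}" i] that unfolding m_def[symmetric] by fastforce
  have dep_y: "(\<Sum>i<k. c $ i * (?r i \<bullet> y)) = 0" if y: "y \<in> carrier_vec k" for y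
  proof -
    have "0 = (transpose_mat (krylov_mat N w k) *\<^sub>v c) \<bullet> y" using dep y by simp
    also have "\<dots> = c \<bullet> (krylov_mat N w k *\<^sub>v y)"
      using transpose_vec_mult_scalar[of "krylov_mat N w k" k k y c] w y c by simp
    also have "\<dots> = (\<Sum>i<k. c $ i * (?r i \<bullet> y))"
      by (simp add: krylov_mat_mult_vec[OF N w] scalar_prod_def[of c] lessThan_atLeast0)
    finally show ?thesis by simp
  qed
  have top: "?r m \<bullet> y = 0" if y: "y \<in> carrier_vec k" and 0: "\<And>i. i < m \<Longrightarrow> ?r i \<bullet> y = 0" for y
  proof -
    have "0 = (\<Sum>i<k. c $ i * (?r i \<bullet> y))" using dep_y[OF y] by simp
    also have "\<dots> = (\<Sum>i<k. if i = m then c $ m * (?r m \<bullet> y) else 0)"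
      using 0 c_above by (intro sum.cong refl) (metis lessThan_iff linorder_neqE_nat mult_zero_left mult_zero_right)
    also have "\<dots> = c $ m * (?r m \<bullet> y)" using m by simp
    finally show ?thesis using m by simp
  qed
  let ?C = "krylov_mat N w m"
  have C: "?C \<in> carrier_mat m k" using w by simp
  have C_iff: "?C *\<^sub>v y = 0\<^sub>v m \<longleftrightarrow> (\<forall>i<m. ?r i \<bullet> y = 0)" for y
    unfolding krylov_mat_mult_vec[OF N w] by (auto simp: vec_eq_iff)
  obtain y where y: "y \<in> carrier_vec k" "y \<noteq> 0\<^sub>v k" "?C *\<^sub>v y = 0\<^sub>v m"
    using underdetermined_has_nonzero_solution[OF C m(1)] by blast
  have "?C *\<^sub>v (N *\<^sub>v y) = 0\<^sub>v m" if y: "y \<in> carrier_vec k" and "?C *\<^sub>v y = 0\<^sub>v m" for y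
  proof -
    have 0: "?r i \<bullet> y = 0" if "i < m" for i using \<open>?C *\<^sub>v y = 0\<^sub>v m\<close> that by (simp add: C_iff)
    have "?r (Suc i) \<bullet> y = 0" if "i < m" for i
      using 0[of "Suc i"] top[OF y 0] that by (cases "Suc i = m") auto
    then show ?thesis using krylov_scalar_prod_Suc[OF N w y] by (simp add: C_iff)
  qed
  from invariant_kernel_has_eigenvector[OF N C this y]
  obtain \<mu> z where z: "z \<in> carrier_vec k" "z \<noteq> 0\<^sub>v k" "?C *\<^sub>v z = 0\<^sub>v m" "N *\<^sub>v z = \<mu> \<cdot>\<^sub>v z" by blast
  \<comment> \<open>For \<open>m = 0\<close> the dependency says that \<open>w = 0\<close>.\<close>
  have "w \<bullet> z = 0"
  proof (cases m)
    case 0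
    then show ?thesis using top[OF z(1)] by simp
  next
    case (Suc i)
    then show ?thesis using z(3) unfolding C_iff by (metis iterates_0 zero_less_Suc)
  qed
  with z show "\<exists>\<mu>. \<exists>y \<in> carrier_vec k. y \<noteq> 0\<^sub>v k \<and> N *\<^sub>v y = \<mu> \<cdot>\<^sub>v y \<and> w \<bullet> y = 0" by blast
qed

section \<open>Counting the pairs with invertible Krylov matrix\<close>

definition shift_rows :: "'a mat \<Rightarrow> 'a vec \<Rightarrow> 'a mat" where
  "shift_rows B u = mat (dim_row B) (dim_col B)
    (\<lambda>(i,j). if Suc i < dim_row B then B $$ (Suc i, j) else u $ j)"

lemma shift_rows_carrier [simp]: "B \<in> carrier_mat m k \<Longrightarrow> shift_rows B u \<in> carrier_mat m k"
  by (auto simp: shift_rows_def)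

text \<open>
  Multiplication by \<open>N\<close> moves the Krylov rows up by one. This determines \<open>N\<close> when the Krylov matrix is
  invertible.
\<close>

lemma krylov_mat_mult:
  assumes N: "(N :: 'a::comm_semiring_0 mat) \<in> carrier_mat k k" and w: "w \<in> carrier_vec k"
  shows "krylov_mat N w m * N = shift_rows (krylov_mat N w m) (iterates (transpose_mat N) w m)"
proof (rule eq_matI)
  let ?r = "iterates (transpose_mat N) w"
  let ?S = "shift_rows (krylov_mat N w m) (?r m)"
  fix i j assume "i < dim_row ?S" "j < dim_col ?S"
  then have ij: "i < m" "j < k" using w by (auto simp: shift_rows_def krylov_mat_def)
  have "(krylov_mat N w m * N) $$ (i, j) = (krylov_mat N w m *\<^sub>v col N j) $ i"
    using ij N w by (simp add: krylov_mat_def)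
  also have "\<dots> = ?r i \<bullet> col N j"
    using ij by (simp add: krylov_mat_mult_vec[OF N w])
  also have "\<dots> = col N j \<bullet> ?r i"
    using N w by (intro comm_scalar_prod[of _ k]) auto
  also have "\<dots> = ?r (Suc i) $ j" using ij N by (simp add: iterates_Suc)
  also have "\<dots> = ?S $$ (i, j)"
  proof (cases "Suc i < m")
    case False
    then have "m = Suc i" using ij by simp
    then show ?thesis using ij w by (simp add: shift_rows_def krylov_mat_def)
  qed (use ij w in \<open>simp add: shift_rows_def krylov_mat_def\<close>)
  finally show "(krylov_mat N w m * N) $$ (i, j) = ?S $$ (i, j)" .
qed (use N w in \<open>auto simp: shift_rows_def krylov_mat_def\<close>)

text \<open>
  Surjectivity of the map from pairs to Krylov matrices rests on this: solving \<open>B N = shift_rows B u\<close> for \<open>N\<close>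
  gives a matrix that has \<open>B\<close> as its Krylov matrix.
\<close>

lemma iterates_rows:
  assumes B: "(B :: 'a::comm_semiring_0 mat) \<in> carrier_mat m k" and u: "u \<in> carrier_vec k" and N: "N \<in> carrier_mat k k"
    and BN: "B * N = shift_rows B u" and "0 < m"
  shows "i < m \<Longrightarrow> iterates (transpose_mat N) (row B 0) i = row B i"
    and "iterates (transpose_mat N) (row B 0) m = u"
proof -
  have step: "transpose_mat N *\<^sub>v row B i = (if Suc i < m then row B (Suc i) else u)" if i: "i < m" for i
  proof (rule eq_vecI)
    fix j assume "j < dim_vec (if Suc i < m then row B (Suc i) else u)"
    then have j: "j < k" using B u by (auto split: if_splits)
    have "(transpose_mat N *\<^sub>v row B i) $ j = col N j \<bullet> row B i" using N j by simp
    also have "\<dots> = row B i \<bullet> col N j"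
      using B N by (intro comm_scalar_prod[of _ k]) auto
    also have "\<dots> = (B * N) $$ (i, j)" using B N i j by simp
    also have "\<dots> = (if Suc i < m then row B (Suc i) else u) $ j"
      unfolding BN using B i j by (simp add: shift_rows_def)
    finally show "(transpose_mat N *\<^sub>v row B i) $ j = (if Suc i < m then row B (Suc i) else u) $ j" .
  qed (use B u N in auto)
  show *: "iterates (transpose_mat N) (row B 0) i = row B i" if "i < m" for i
    using that by (induction i) (simp_all add: iterates_Suc step)
  obtain l where l: "m = Suc l" using \<open>0 < m\<close> by (cases m) auto
  then show "iterates (transpose_mat N) (row B 0) m = u" by (simp add: iterates_Suc * step)
qed

text \<open>
  In control theory these are the observable systems with state matrix \<open>N\<close> and a single output \<open>w\<close>.
\<close>

definition observable_pairs :: "nat \<Rightarrow> ('a::field mat \<times> 'a vec) set" where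
  "observable_pairs k =
    {(N, w). N \<in> carrier_mat k k \<and> w \<in> carrier_vec k \<and> det (krylov_mat N w k) \<noteq> 0}"

lemma bij_betw_krylov:
  assumes "0 < k"
  shows "bij_betw (\<lambda>(N, w). (krylov_mat N w k, iterates (transpose_mat N) w k))
    (observable_pairs k) ({B \<in> carrier_mat k k. det (B :: 'a::field mat) \<noteq> 0} \<times> carrier_vec k)"
  unfolding bij_betw_def
proof (intro conjI inj_onI equalityI subsetI)
  fix p p' :: "'a mat \<times> 'a vec"
  assume p: "p \<in> observable_pairs k" and p': "p' \<in> observable_pairs k"
    and eq: "(\<lambda>(N, w). (krylov_mat N w k, iterates (transpose_mat N) w k)) p =
      (\<lambda>(N, w). (krylov_mat N w k, iterates (transpose_mat N) w k)) p'"
  obtain N w where Nw: "p = (N, w)" by (cases p)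
  obtain N' w' where Nw': "p' = (N', w')" by (cases p')
  have N: "N \<in> carrier_mat k k" "w \<in> carrier_vec k" "det (krylov_mat N w k) \<noteq> 0"
    using p Nw by (auto simp: observable_pairs_def)
  have N': "N' \<in> carrier_mat k k" "w' \<in> carrier_vec k"
    using p' Nw' by (auto simp: observable_pairs_def)
  have K: "krylov_mat N w k = krylov_mat N' w' k"
    and u: "iterates (transpose_mat N) w k = iterates (transpose_mat N') w' k"
    using eq Nw Nw' by auto
  have "w = w'"
  proof (rule eq_vecI)
    fix j assume "j < dim_vec w'"
    then show "w $ j = w' $ j"
      using arg_cong[OF K, of "\<lambda>A. A $$ (0, j)"] N N' \<open>0 < k\<close> by (simp add: krylov_mat_def)
  qed (use N N' in simp)
  have KN: "krylov_mat N w k * N = krylov_mat N w k * N'"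
    unfolding krylov_mat_mult[OF N(1,2)] using krylov_mat_mult[OF N', of k] K u by simp
  obtain B where B: "B \<in> carrier_mat k k" "B * krylov_mat N w k = 1\<^sub>m k"
    using det_nonzero_obtains_inverse[of "krylov_mat N w k" k] N by auto
  have "N = B * (krylov_mat N w k * N)"
    using B N by (simp add: assoc_mult_mat[symmetric, of _ k k _ k _ k])
  also have "\<dots> = N'"
    unfolding KN using B N N' by (simp add: assoc_mult_mat[symmetric, of _ k k _ k _ k])
  finally show "p = p'" using Nw Nw' \<open>w = w'\<close> by simp
next
  fix p :: "'a mat \<times> 'a vec"
  assume "p \<in> (\<lambda>(N, w). (krylov_mat N w k, iterates (transpose_mat N) w k)) ` observable_pairs k"
  then show "p \<in> {B \<in> carrier_mat k k. det B \<noteq> 0} \<times> carrier_vec k"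
    by (auto simp: observable_pairs_def)
next
  fix p :: "'a mat \<times> 'a vec"
  assume "p \<in> {B \<in> carrier_mat k k. det B \<noteq> 0} \<times> carrier_vec k"
  then obtain B u where p: "p = (B, u)" and B: "B \<in> carrier_mat k k" "det B \<noteq> 0"
    and u: "u \<in> carrier_vec k" by auto
  obtain B' where B': "B' \<in> carrier_mat k k" "B * B' = 1\<^sub>m k"
    using det_nonzero_obtains_inverse[OF B] by auto
  define N where "N = B' * shift_rows B u"
  define w where "w = row B 0"
  have S: "shift_rows B u \<in> carrier_mat k k" using B by simp
  have N: "N \<in> carrier_mat k k" using B' S by (simp add: N_def)
  have w: "w \<in> carrier_vec k" using row_carrier_vec[of 0 k B k] B \<open>0 < k\<close> by (simp add: w_def)
  have BN: "B * N = shift_rows B u"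
    unfolding N_def using assoc_mult_mat[OF B(1) B'(1) S, symmetric] B'(2) S by simp
  note rows = iterates_rows[OF B(1) u N BN \<open>0 < k\<close>, folded w_def]
  have "krylov_mat N w k = B"
    using B w by (intro eq_matI) (auto simp: krylov_mat_def rows)
  then show "p \<in> (\<lambda>(N, w). (krylov_mat N w k, iterates (transpose_mat N) w k)) ` observable_pairs k"
    using p B N w rows(2) by (intro image_eqI[where x = "(N, w)"]) (auto simp: observable_pairs_def)
qed

lemma card_observable_pairs:
  assumes "0 < k"
  shows "card (observable_pairs k :: ('a::{field,finite} mat \<times> 'a vec) set) =
    (\<Prod>i<k. CARD('a) ^ k - CARD('a) ^ i) * CARD('a) ^ k"
proof -
  have "{B \<in> carrier_mat k k. det (B :: 'a mat) \<noteq> 0} = {B \<in> carrier_mat k k. full_column_rank B}"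
    using full_column_rank_square by blast
  then show ?thesis
    using bij_betw_same_card[OF bij_betw_krylov[OF assms, where 'a = 'a]]
    by (simp add: card_cartesian_product card_full_column_rank card_carrier_vec)
qed


section \<open>Normalizing the first slice\<close>

definition append_row :: "'a mat \<Rightarrow> 'a vec \<Rightarrow> 'a mat" where
  "append_row N w = mat (Suc (dim_row N)) (dim_col N)
    (\<lambda>(i,j). if i < dim_row N then N $$ (i,j) else w $ j)"

lemma append_row_carrier [simp]: "N \<in> carrier_mat m k \<Longrightarrow> append_row N w \<in> carrier_mat (Suc m) k"
  by (auto simp: append_row_def)

lemma append_row_mult_vec:
  assumes N: "N \<in> carrier_mat m k" and w: "w \<in> carrier_vec k"
  shows "append_row N w *\<^sub>v y = vec (Suc m) (\<lambda>i. if i < m then (N *\<^sub>v y) $ i else w \<bullet> y)"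
proof (rule eq_vecI)
  fix i assume "i < dim_vec (vec (Suc m) (\<lambda>i. if i < m then (N *\<^sub>v y) $ i else w \<bullet> y))"
  then have i: "i < Suc m" by simp
  have "row (append_row N w) i = (if i < m then row N i else w)"
    using i N w by (intro eq_vecI) (auto simp: append_row_def)
  then show "(append_row N w *\<^sub>v y) $ i = vec (Suc m) (\<lambda>i. if i < m then (N *\<^sub>v y) $ i else w \<bullet> y) $ i"
    using i N by (simp add: append_row_def[of N w] del: row_mat)
qed (use N in \<open>simp add: append_row_def\<close>)

lemma smult_mat_mult_vec:
  fixes A :: "'a::comm_semiring_0 mat"
  assumes "A \<in> carrier_mat m k" "y \<in> carrier_vec k"
  shows "(a \<cdot>\<^sub>m A) *\<^sub>v y = a \<cdot>\<^sub>v (A *\<^sub>v y)"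
  using assms by (intro eq_vecI) (auto simp: scalar_prod_def sum_distrib_left mult.assoc)

text \<open>
  Multiplication by the inverse of \<open>Q\<close> turns the pencil at \<open>x\<close> into \<open>x\<^sub>0 I + x\<^sub>1 N\<close> with the row \<open>x\<^sub>1 w\<close> below it.
  A nonzero kernel vector forces \<open>x\<^sub>1 \<noteq> 0\<close>, and then it is an eigenvector of \<open>N\<close> for
  \<open>\<mu> = - x\<^sub>0 / x\<^sub>1\<close>.
\<close>

lemma pencil_kernel_iff_unobservable_eigenvector:
  fixes M0 :: "'a::field mat"
  assumes M0: "M0 \<in> carrier_mat (Suc k) k" and c: "c \<in> carrier_vec (Suc k)"
    and det: "det (append_col M0 c) \<noteq> 0"
    and N: "N \<in> carrier_mat k k" and w: "w \<in> carrier_vec k"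
  shows "(\<exists>x \<in> carrier_vec 2. \<exists>y \<in> carrier_vec k. x \<noteq> 0\<^sub>v 2 \<and> y \<noteq> 0\<^sub>v k \<and>
      pencil M0 (append_col M0 c * append_row N w) x *\<^sub>v y = 0\<^sub>v (Suc k)) \<longleftrightarrow>
    (\<exists>\<mu>. \<exists>y \<in> carrier_vec k. y \<noteq> 0\<^sub>v k \<and> N *\<^sub>v y = \<mu> \<cdot>\<^sub>v y \<and> w \<bullet> y = 0)"
proof -
  let ?Q = "append_col M0 c" and ?R = "append_row N w"
  have Q: "?Q \<in> carrier_mat (Suc k) (Suc k)" using M0 by simp
  have R: "?R \<in> carrier_mat (Suc k) k" using N by simp
  have kernel: "pencil M0 (?Q * ?R) x *\<^sub>v y = 0\<^sub>v (Suc k) \<longleftrightarrow>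
      (\<forall>i<k. x $ 0 * y $ i + x $ 1 * (N *\<^sub>v y) $ i = 0) \<and> x $ 1 * (w \<bullet> y) = 0"
    if y: "y \<in> carrier_vec k" for x y
  proof -
    let ?y = "vec (Suc k) (\<lambda>i. if i < k then y $ i else 0)"
    \<comment> \<open>\<open>?v\<close> is the pencil in the new coordinates, applied to \<open>y\<close>.\<close>
    let ?v = "x $ 0 \<cdot>\<^sub>v ?y + x $ 1 \<cdot>\<^sub>v (?R *\<^sub>v y)"
    have "M0 *\<^sub>v y = ?Q *\<^sub>v ?y"
    proof -
      have "vec k (($) ?y) = y" using y by (intro eq_vecI) auto
      moreover have "0 \<cdot>\<^sub>v c = 0\<^sub>v (Suc k)" using c by auto
      ultimately show ?thesis using append_col_mult_vec[OF M0 c, of ?y] M0 y by simp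
    qed
    moreover have "(?Q * ?R) *\<^sub>v y = ?Q *\<^sub>v (?R *\<^sub>v y)" using assoc_mult_mat_vec[OF Q R y] .
    moreover have "pencil M0 (?Q * ?R) x *\<^sub>v y = x $ 0 \<cdot>\<^sub>v (M0 *\<^sub>v y) + x $ 1 \<cdot>\<^sub>v ((?Q * ?R) *\<^sub>v y)"
    proof -
      have QR: "?Q * ?R \<in> carrier_mat (Suc k) k" using Q R by simp
      show ?thesis
        unfolding pencil_def
        using add_mult_distrib_mat_vec[of "x $ 0 \<cdot>\<^sub>m M0" "Suc k" k "x $ 1 \<cdot>\<^sub>m (?Q * ?R)" y]
          smult_mat_mult_vec[OF M0 y] smult_mat_mult_vec[OF QR y] M0 QR y
        by simp
    qed
    moreover have "?Q *\<^sub>v ?v = x $ 0 \<cdot>\<^sub>v (?Q *\<^sub>v ?y) + x $ 1 \<cdot>\<^sub>v (?Q *\<^sub>v (?R *\<^sub>v y))"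
      using mult_add_distrib_mat_vec[OF Q, of "x $ 0 \<cdot>\<^sub>v ?y" "x $ 1 \<cdot>\<^sub>v (?R *\<^sub>v y)"]
        mult_mat_vec[OF Q, of ?y] mult_mat_vec[OF Q, of "?R *\<^sub>v y"] R y by simp
    ultimately have "pencil M0 (?Q * ?R) x *\<^sub>v y = ?Q *\<^sub>v ?v" by simp
    have v: "?v \<in> carrier_vec (Suc k)"
      by (intro add_carrier_vec smult_carrier_vec[THEN iffD2] vec_carrier mult_mat_vec_carrier[OF R y])
    have "pencil M0 (?Q * ?R) x *\<^sub>v y = 0\<^sub>v (Suc k) \<longleftrightarrow> ?v = 0\<^sub>v (Suc k)"
    proof -
      have "?Q *\<^sub>v ?v = 0\<^sub>v (Suc k) \<Longrightarrow> ?v = 0\<^sub>v (Suc k)"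
        using det_0_iff_vec_prod_zero_field[OF Q] det v by blast
      moreover have "?Q *\<^sub>v 0\<^sub>v (Suc k) = 0\<^sub>v (Suc k)"
        using Q by (intro eq_vecI) simp_all
      ultimately show ?thesis using \<open>pencil M0 (?Q * ?R) x *\<^sub>v y = ?Q *\<^sub>v ?v\<close> by metis
    qed
    also have "\<dots> \<longleftrightarrow> (\<forall>i<Suc k. ?v $ i = 0)" using vec_eq_zero_iff[OF v] .
    also have "\<dots> \<longleftrightarrow> (\<forall>i<k. x $ 0 * y $ i + x $ 1 * (N *\<^sub>v y) $ i = 0) \<and> x $ 1 * (w \<bullet> y) = 0"
      unfolding append_row_mult_vec[OF N w] by (auto simp: less_Suc_eq)
    finally show ?thesis .
  qed
  show ?thesis
  proof (intro iffI; elim bexE exE conjE)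
    fix x y assume x: "x \<in> carrier_vec 2" "x \<noteq> 0\<^sub>v 2" and y: "y \<in> carrier_vec k" "y \<noteq> 0\<^sub>v k"
      and "pencil M0 (?Q * ?R) x *\<^sub>v y = 0\<^sub>v (Suc k)"
    then have combination: "\<forall>i<k. x $ 0 * y $ i + x $ 1 * (N *\<^sub>v y) $ i = 0"
      and annihilated: "x $ 1 * (w \<bullet> y) = 0"
      using kernel[OF y(1)] by blast+
    have "x $ 1 \<noteq> 0"
    proof
      assume x1: "x $ 1 = 0"
      with x have "x $ 0 \<noteq> 0" by (auto simp: vec_eq_zero_iff[OF x(1)] less_2_cases_iff)
      then have "y $ i = 0" if "i < k" for i using combination that x1 by simp
      with y show False by (simp add: vec_eq_zero_iff[OF y(1)])
    qed
    moreover have "N *\<^sub>v y = (- x $ 0 / x $ 1) \<cdot>\<^sub>v y"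
    proof (rule eq_vecI)
      fix i assume "i < dim_vec ((- x $ 0 / x $ 1) \<cdot>\<^sub>v y)"
      then have i: "i < k" using y by simp
      have "x $ 1 * (N *\<^sub>v y) $ i = - (x $ 0 * y $ i)" using combination i by (simp only: add_eq_0_iff)
      then show "(N *\<^sub>v y) $ i = ((- x $ 0 / x $ 1) \<cdot>\<^sub>v y) $ i"
        using \<open>x $ 1 \<noteq> 0\<close> i y by (simp add: field_simps del: index_mult_mat_vec)
    qed (use N y in auto)
    ultimately show "\<exists>\<mu>. \<exists>y \<in> carrier_vec k. y \<noteq> 0\<^sub>v k \<and> N *\<^sub>v y = \<mu> \<cdot>\<^sub>v y \<and> w \<bullet> y = 0"
      using y annihilated by auto
  next
    fix \<mu> y assume y: "y \<in> carrier_vec k" "y \<noteq> 0\<^sub>v k" and "N *\<^sub>v y = \<mu> \<cdot>\<^sub>v y" "w \<bullet> y = 0"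
    let ?x = "vec 2 (\<lambda>p. if p = 0 then - \<mu> else 1)"
    have "?x $ 1 \<noteq> 0" by simp
    then have "?x \<noteq> 0\<^sub>v 2" by (metis index_zero_vec(1) one_less_numeral_iff semiring_norm(76))
    moreover have "pencil M0 (?Q * ?R) ?x *\<^sub>v y = 0\<^sub>v (Suc k)"
      unfolding kernel[OF y(1)] using \<open>N *\<^sub>v y = \<mu> \<cdot>\<^sub>v y\<close> \<open>w \<bullet> y = 0\<close> y by simp
    ultimately show "\<exists>x \<in> carrier_vec 2. \<exists>y \<in> carrier_vec k. x \<noteq> 0\<^sub>v 2 \<and> y \<noteq> 0\<^sub>v k \<and>
      pencil M0 (?Q * ?R) x *\<^sub>v y = 0\<^sub>v (Suc k)" using y vec_carrier by blast
  qed
qed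

interpretation to_ac: inj_comm_ring_hom to_ac
  by unfold_locales auto

lemma iterates_to_ac:
  assumes "N \<in> carrier_mat k k" "w \<in> carrier_vec k"
  shows "iterates (map_mat to_ac N) (map_vec to_ac w) i = map_vec to_ac (iterates N w i)"
  using assms by (induction i) (auto simp: iterates_Suc to_ac.mult_mat_vec_hom[of N k k])

lemma det_krylov_mat_to_ac:
  assumes N: "N \<in> carrier_mat k k" and w: "w \<in> carrier_vec k"
  shows "det (krylov_mat (map_mat to_ac N) (map_vec to_ac w) k) = 0 \<longleftrightarrow> det (krylov_mat N w k) = 0"
proof -
  have T: "transpose_mat N \<in> carrier_mat k k" using N by simp
  have "krylov_mat (map_mat to_ac N) (map_vec to_ac w) k = map_mat to_ac (krylov_mat N w k)"
    using w dim_iterates[OF T w] iterates_to_ac[OF T w]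
    by (intro eq_matI) (auto simp: krylov_mat_def map_mat_transpose)
  then show ?thesis by simp
qed

text \<open>
  The kernel and eigenvector conditions live over the algebraic closure, but the determinant of the Krylov matrix
  lies in the base field, so that nondegeneracy can be decided there.
\<close>

lemma degenerate_iff_krylov_det_zero:
  assumes M0: "M0 \<in> carrier_mat (Suc k) k" and c: "c \<in> carrier_vec (Suc k)"
    and det: "det (append_col M0 c) \<noteq> 0"
    and N: "N \<in> carrier_mat k k" and w: "w \<in> carrier_vec k"
  shows "degenerate k (M0, append_col M0 c * append_row N w) \<longleftrightarrow> det (krylov_mat N w k) = 0"
proof -
  let ?Q = "append_col M0 c" and ?R = "append_row N w"
  have Q: "?Q \<in> carrier_mat (Suc k) (Suc k)" using M0 by simp
  have R: "?R \<in> carrier_mat (Suc k) k" using N by simp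
  have mapQ: "append_col (map_mat to_ac M0) (map_vec to_ac c) = map_mat to_ac ?Q"
    using M0 c by (intro eq_matI) (auto simp: append_col_def)
  have mapR: "append_row (map_mat to_ac N) (map_vec to_ac w) = map_mat to_ac ?R"
    using N w by (intro eq_matI) (auto simp: append_row_def)
  have detQ: "det (append_col (map_mat to_ac M0) (map_vec to_ac c)) \<noteq> 0"
    unfolding mapQ using det by simp
  have "(M0, ?Q * ?R) \<in> hypermatrices k"
    using M0 mult_carrier_mat[OF Q R] by (simp add: hypermatrices_def)
  from degenerate_iff_pencil_kernel[OF this]
  have "degenerate k (M0, ?Q * ?R) \<longleftrightarrow> (\<exists>x \<in> carrier_vec 2. \<exists>y \<in> carrier_vec k.
      x \<noteq> 0\<^sub>v 2 \<and> y \<noteq> 0\<^sub>v k \<and> pencil (map_mat to_ac M0)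
        (append_col (map_mat to_ac M0) (map_vec to_ac c) * append_row (map_mat to_ac N) (map_vec to_ac w)) x
        *\<^sub>v y = 0\<^sub>v (Suc k))"
    by (simp add: to_ac.mat_hom_mult[OF Q R] mapQ mapR)
  also have "\<dots> \<longleftrightarrow> det (krylov_mat (map_mat to_ac N) (map_vec to_ac w) k) = 0"
    using M0 c N w
    by (subst pencil_kernel_iff_unobservable_eigenvector[OF _ _ detQ])
       (simp_all add: krylov_det_zero_iff_unobservable_eigenvector)
  finally show ?thesis using det_krylov_mat_to_ac[OF N w] by simp
qed

text \<open>
  The first slice is the member of the pencil at \<open>x = (1, 0)\<close>.
\<close>

lemma degenerate_if_not_full_column_rank:
  assumes M0: "M0 \<in> carrier_mat (Suc k) k" and M1: "M1 \<in> carrier_mat (Suc k) k"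
    and "\<not> full_column_rank M0"
  shows "degenerate k (M0, M1)"
proof -
  obtain y where y: "y \<in> carrier_vec k" "y \<noteq> 0\<^sub>v k" "M0 *\<^sub>v y = 0\<^sub>v (Suc k)"
    using assms unfolding full_column_rank_def by auto
  let ?M0 = "map_mat to_ac M0" and ?M1 = "map_mat to_ac M1"
  let ?y = "map_vec to_ac y" and ?x = "unit_vec 2 0 :: 'a alg_closure vec"
  have "pencil ?M0 ?M1 ?x = ?M0"
    using M0 M1 by (intro eq_matI) (auto simp: pencil_def)
  then have "pencil ?M0 ?M1 ?x *\<^sub>v ?y = 0\<^sub>v (Suc k)"
    using to_ac.mult_mat_vec_hom[OF M0 y(1)] y(3) by (simp add: to_ac.vec_hom_zero)
  moreover have "?x \<in> carrier_vec 2" "?x \<noteq> 0\<^sub>v 2" "?y \<in> carrier_vec k" "?y \<noteq> 0\<^sub>v k"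
    using y by auto
  moreover have "(M0, M1) \<in> hypermatrices k" using M0 M1 by (simp add: hypermatrices_def)
  ultimately show ?thesis
    unfolding degenerate_iff_pencil_kernel[OF \<open>(M0, M1) \<in> hypermatrices k\<close>] fst_conv snd_conv
      Suc_eq_plus1[symmetric]
    by blast
qed

lemma bij_betw_mult_append_row:
  fixes Q :: "'a::field mat"
  assumes Q: "Q \<in> carrier_mat (Suc k) (Suc k)" and "det Q \<noteq> 0"
  shows "bij_betw (\<lambda>(N, w). Q * append_row N w) (carrier_mat k k \<times> carrier_vec k) (carrier_mat (Suc k) k)"
proof -
  obtain P where P: "P \<in> carrier_mat (Suc k) (Suc k)" "Q * P = 1\<^sub>m (Suc k)" "P * Q = 1\<^sub>m (Suc k)"
    using det_nonzero_obtains_inverse[OF assms] by blast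
  have PQ: "P * (Q * A) = A" and QP: "Q * (P * A) = A" if "A \<in> carrier_mat (Suc k) k" for A
    using assoc_mult_mat[OF P(1) Q that] assoc_mult_mat[OF Q P(1) that] P that by simp_all
  have split_append: "mat k k (($$) (append_row N w)) = N" "row (append_row N w) k = w"
    if "N \<in> carrier_mat k k" "w \<in> carrier_vec k" for N and w :: "'a vec"
    using that by (auto simp: append_row_def intro!: eq_matI eq_vecI)
  have append_split: "append_row (mat k k (($$) A)) (row A k) = A"
    if "A \<in> carrier_mat (Suc k) k" for A :: "'a mat"
    using that by (auto simp: append_row_def less_Suc_eq intro!: eq_matI)
  show ?thesis
  proof (rule bij_betw_byWitness[where f' = "\<lambda>A. (mat k k (($$) (P * A)), row (P * A) k)"])
    show "\<forall>p \<in> carrier_mat k k \<times> carrier_vec k.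
        (\<lambda>A. (mat k k (($$) (P * A)), row (P * A) k)) ((\<lambda>(N, w). Q * append_row N w) p) = p"
      using PQ split_append by auto
    show "\<forall>A \<in> carrier_mat (Suc k) k.
        (\<lambda>(N, w). Q * append_row N w) (mat k k (($$) (P * A)), row (P * A) k) = A"
    proof
      fix A :: "'a mat" assume A: "A \<in> carrier_mat (Suc k) k"
      then have "append_row (mat k k (($$) (P * A))) (row (P * A) k) = P * A"
        using append_split mult_carrier_mat[OF P(1) A] by blast
      then show "(\<lambda>(N, w). Q * append_row N w) (mat k k (($$) (P * A)), row (P * A) k) = A"
        using QP[OF A] by (simp only: prod.case)
    qed
    show "(\<lambda>(N, w). Q * append_row N w) ` (carrier_mat k k \<times> carrier_vec k) \<subseteq> carrier_mat (Suc k) k"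
      using Q by auto
    show "(\<lambda>A. (mat k k (($$) (P * A)), row (P * A) k)) ` carrier_mat (Suc k) k
        \<subseteq> carrier_mat k k \<times> carrier_vec k"
      using P by auto
  qed
qed

lemma card_nondegenerate_second_slices:
  fixes M0 :: "'a::{field,finite} mat"
  assumes M0: "M0 \<in> carrier_mat (Suc k) k" "full_column_rank M0"
  shows "card {M1 \<in> carrier_mat (Suc k) k. \<not> degenerate k (M0, M1)} =
    card (observable_pairs k :: ('a mat \<times> 'a vec) set)"
proof -
  obtain c where c: "c \<in> carrier_vec (Suc k)" "det (append_col M0 c) \<noteq> 0"
    using full_column_rank_extend_to_invertible[OF M0] .
  let ?f = "\<lambda>(N, w). append_col M0 c * append_row N w"
  have bij: "bij_betw ?f (carrier_mat k k \<times> carrier_vec k) (carrier_mat (Suc k) k)"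
    using bij_betw_mult_append_row[of "append_col M0 c" k] M0 c by simp
  have deg: "degenerate k (M0, append_col M0 c * append_row N w) \<longleftrightarrow> det (krylov_mat N w k) = 0"
    if "N \<in> carrier_mat k k" "w \<in> carrier_vec k" for N w
    using degenerate_iff_krylov_det_zero[OF M0(1) c that] .
  have "bij_betw ?f (observable_pairs k) {M1 \<in> carrier_mat (Suc k) k. \<not> degenerate k (M0, M1)}"
  proof (rule bij_betw_subset[OF bij])
    show "observable_pairs k \<subseteq> carrier_mat k k \<times> (carrier_vec k :: 'a vec set)"
      by (auto simp: observable_pairs_def)
    show "?f ` observable_pairs k = {M1 \<in> carrier_mat (Suc k) k. \<not> degenerate k (M0, M1)}"
    proof (intro equalityI subsetI)
      fix M1 assume "M1 \<in> ?f ` observable_pairs k"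
      then obtain N w where "N \<in> carrier_mat k k" "w \<in> carrier_vec k" "det (krylov_mat N w k) \<noteq> 0"
        "M1 = append_col M0 c * append_row N w" by (auto simp: observable_pairs_def)
      then show "M1 \<in> {M1 \<in> carrier_mat (Suc k) k. \<not> degenerate k (M0, M1)}"
        using deg[of N w] M0 by (auto intro!: mult_carrier_mat[of _ _ "Suc k"])
    next
      fix M1 assume M1: "M1 \<in> {M1 \<in> carrier_mat (Suc k) k. \<not> degenerate k (M0, M1)}"
      then have "M1 \<in> ?f ` (carrier_mat k k \<times> carrier_vec k)"
        using bij_betw_imp_surj_on[OF bij] by simp
      then obtain N w where "N \<in> carrier_mat k k" "w \<in> carrier_vec k"
        "M1 = append_col M0 c * append_row N w" by (elim imageE SigmaE) simp
      then show "M1 \<in> ?f ` observable_pairs k"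
        using deg[of N w] M1 by (intro image_eqI[where x = "(N, w)"]) (simp_all add: observable_pairs_def)
    qed
  qed
  from bij_betw_same_card[OF this] show ?thesis by (rule sym)
qed

section \<open>The count\<close>

lemma card_nondegenerate:
  assumes "0 < k"
  shows "card {M \<in> hypermatrices k. \<not> degenerate k (M :: 'a::{field,finite} hypermatrix)} =
    (\<Prod>i<k. CARD('a) ^ (k + 1) - CARD('a) ^ i) *
    ((\<Prod>i<k. CARD('a) ^ k - CARD('a) ^ i) * CARD('a) ^ k)"
proof -
  let ?S = "{M0 \<in> carrier_mat (k + 1) k. full_column_rank (M0 :: 'a mat)}"
  let ?T = "\<lambda>M0 :: 'a mat. {M1 \<in> carrier_mat (Suc k) k. \<not> degenerate k (M0, M1)}"
  have "{M \<in> hypermatrices k. \<not> degenerate k (M :: 'a hypermatrix)} = (SIGMA M0:?S. ?T M0)"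
    using degenerate_if_not_full_column_rank[where 'a = 'a and k = k]
    by (auto simp: hypermatrices_def)
  moreover have "finite ?S"
    by (rule finite_subset[OF _ finite_carrier_mat[of "k + 1" k]]) blast
  moreover have "finite (?T M0)" for M0
    by (rule finite_subset[OF _ finite_carrier_mat[of "Suc k" k]]) blast
  ultimately have "card {M \<in> hypermatrices k. \<not> degenerate k (M :: 'a hypermatrix)} =
      (\<Sum>M0\<in>?S. card (?T M0))"
    by (simp add: card_SigmaI)
  also have "\<dots> = (\<Sum>M0\<in>?S. (\<Prod>i<k. CARD('a) ^ k - CARD('a) ^ i) * CARD('a) ^ k)"
    using card_nondegenerate_second_slices[where 'a = 'a] card_observable_pairs[OF assms, where 'a = 'a]
    by (intro sum.cong) auto
  also have "\<dots> = card ?S * ((\<Prod>i<k. CARD('a) ^ k - CARD('a) ^ i) * CARD('a) ^ k)" by simp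
  finally show ?thesis unfolding card_full_column_rank .
qed

lemma power_diff_eq_q_int:
  fixes q :: nat
  assumes "i \<le> n" "q > 0"
  shows "q ^ n - q ^ i = q ^ i * (q - 1) * q_int q (n - i)"
proof -
  have "(q - 1) * q_int q m + 1 = q ^ m" for m
  proof -
    obtain r where "q = Suc r" using \<open>q > 0\<close> by (cases q) auto
    then show ?thesis by (induction m) (auto simp: q_int_def algebra_simps)
  qed
  then have "q ^ n = q ^ i * ((q - 1) * q_int q (n - i) + 1)"
    using \<open>i \<le> n\<close> by (simp add: power_add[symmetric])
  then show ?thesis by (simp add: algebra_simps)
qed

text \<open>
  The cases \<open>d = 0\<close> and \<open>d = 1\<close> give the number of invertible \<open>k \<times> k\<close> matrices and of
  \<open>(k + 1) \<times> k\<close> matrices of full column rank. The products of the \<open>q\<^sup>i\<close> are kept unevaluated, which avoids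
  exponents \<open>k (k - 1) / 2\<close>.
\<close>

lemma prod_power_diff_eq_q_fact:
  fixes q :: nat
  assumes "q > 0"
  shows "(\<Prod>i<k. q ^ (k + d) - q ^ i) * q_fact q d =
    (\<Prod>i<k. q ^ i) * (q - 1) ^ k * q_fact q (k + d)"
proof -
  have "(\<Prod>i<k. q ^ (k + d) - q ^ i) = (\<Prod>i<k. q ^ i * (q - 1) * q_int q (k + d - i))"
    using assms by (intro prod.cong refl power_diff_eq_q_int) auto
  also have "\<dots> = (\<Prod>i<k. q ^ i) * (q - 1) ^ k * (\<Prod>i<k. q_int q (k + d - i))"
    by (simp add: prod.distrib)
  finally have factors: "(\<Prod>i<k. q ^ (k + d) - q ^ i) = \<dots>" .
  have "(\<Prod>i<k. q_int q (k + d - i)) * q_fact q d = (q_fact q (k + d) :: nat)"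
  proof (induction k)
    case (Suc k)
    have "q_fact q (Suc k + d) = q_int q (Suc k + d) * q_fact q (k + d)"
      by (simp add: q_fact_def mult.commute)
    then show ?case using Suc by (simp add: prod.lessThan_Suc_shift mult.assoc del: prod.lessThan_Suc)
  qed simp
  then show ?thesis unfolding factors by (simp add: mult.assoc)
qed

theorem proposition3p1:
  fixes k q :: nat
  assumes "k \<ge> 1"
    and "CARD('a::{field, finite}) = q"
  shows "card {M \<in> hypermatrices k. \<not> degenerate k (M :: 'a hypermatrix)} =
    q ^ (k\<^sup>2) * (q - 1) ^ (2 * k) * q_fact q k * q_fact q (k + 1)"
proof -
  have "q > 0" using assms(2) by auto
  have "q_fact q 0 = 1" "q_fact q 1 = 1" by (simp_all add: q_fact_def q_int_def)
  then have GL: "(\<Prod>i<k. q ^ k - q ^ i) = (\<Prod>i<k. q ^ i) * (q - 1) ^ k * q_fact q k"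
    and frames: "(\<Prod>i<k. q ^ (k + 1) - q ^ i) = (\<Prod>i<k. q ^ i) * (q - 1) ^ k * q_fact q (k + 1)"
    using prod_power_diff_eq_q_fact[OF \<open>q > 0\<close>, of k 0] prod_power_diff_eq_q_fact[OF \<open>q > 0\<close>, of k 1]
    by simp_all
  have square: "(\<Prod>i<k. q ^ i) * (\<Prod>i<k. q ^ i) * q ^ k = q ^ (k\<^sup>2)"
    by (induction k) (simp_all add: power2_eq_square power_add algebra_simps)
  have "card {M \<in> hypermatrices k. \<not> degenerate k (M :: 'a hypermatrix)} =
      ((\<Prod>i<k. q ^ i) * (\<Prod>i<k. q ^ i) * q ^ k) * ((q - 1) ^ k * (q - 1) ^ k) *
      q_fact q k * q_fact q (k + 1)"
  proof -
    have "0 < k" using assms(1) by simp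
    from card_nondegenerate[OF this, where 'a = 'a] show ?thesis
      unfolding assms(2) GL frames by (simp only: mult_ac)
  qed
  also have "\<dots> = q ^ (k\<^sup>2) * (q - 1) ^ (2 * k) * q_fact q k * q_fact q (k + 1)"
    unfolding square by (simp only: power_add mult_2)
  finally show ?thesis .
qed

end
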